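(* Let the cost $c:\mathcal S\times\mathcal U\to[0,\infty)$ be time-independent and assume: (1) for each $x$, $u\mapsto c(x,u)$ is lower semicontinuous and convex on $\mathcal U$; (2) $\mathcal U$ is convex and $u\mapsto\mathcal G^uf(x)$ is affine for every $f\in\mathcal D$, $x\in\mathcal S$; (3) $\sup_{x,u}q(x,\mathcal S;u)<\infty$, and there is $\kappa_V<\infty$ with $\sup_{u\in\mathcal U}\int_{\mathcal S}(1+V(y))\,q(x,dy;u)\le\kappa_V(1+V(x))$ for all $x$; (4) there exist $h:\mathcal S\to\mathbb R$ with $\|h\|_V=\sup_x|h(x)|/(1+V(x))<\infty$ and $g^*\in\mathbb R$ such that, with a (measurable) pointwise maximizer $u^{**}(x)\in\arg\max_{u\in\mathcal U}\{\mathcal G^uh(x)-c(x,u)\}$, one has $g^*+\mathcal G^{u^{**}}h(x)=c(x,u^{**}(x))$ for all $x$; (5) $x\mapsto\inf_{u\in\mathcal U}c(x,u)$ has relatively compact sublevel sets and $c$ is bounded on compact subsets of $\mathcal S\times\mathcal U$; $-h$ is bounded below with relatively compact sublevel sets; the process generated by $u^{**}$ is irreducible; (6) the invariant probability measure $\tilde\pi^*$ of the process generated by $u^{**}$ (which exists and is unique under the preceding hypotheses) satisfies $\langle V,\tilde\pi^*\rangle<\infty$. Then: (i) The ergodic self-transport problem has value $g^*$: $$\inf_{\tilde\pi\in\mathcal P(\mathcal S)}\ \liminf_{T\to\infty}\frac1T\,g_T(\tilde\pi)=g^*.$$ (ii) If, in addition, $u^{**}$ is an admissible stationary control and every admissible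 stationary control $\mu$ satisfies $\langle V,\tilde\pi_\mu\rangle<\infty$, where $\tilde\pi_\mu$ is the invariant law of the process generated by $\mu$, then the ergodic control value also equals $g^*$: $g^{\mathrm{erg}}=g^*$. Thus the long-run average-cost control problem and the ergodic self-transport problem have the same value.
   Context: Setting. $\mathcal S$ is a countable set with the discrete topology; $\mathcal U$ is a compact metric space (when convex, a compact convex subset of $\mathbb R^k$). The controlled jump generators are $\mathcal G^uf(x)=\int_{\mathcal S}[f(y)-f(x)]\,q(x,dy;u)$, with $q(x,\cdot\,;u)$ a (measurable) jump-rate kernel, acting on a common core $\mathcal D\subseteq C_b(\mathcal S)$ (on countable $\mathcal S$: the linear span of constants and singleton indicators). For a stationary control $\mu:\mathcal S\to\mathcal U$, $\mathcal G^\mu f(x)=\mathcal G^{\mu(x)}f(x)$; the process generated by $\mu$ is the Markov jump process with generator $\mathcal G^\mu$. $\langle\phi,\nu\rangle=\int\phi\,d\nu$. Standing stability assumption: $V:\mathcal S\to[0,\infty)$ has relatively compact (finite) sublevel sets, and there are $W:\mathcal S\to[1,\infty)$, a compact $C\subset\mathcal S$ and $b<\infty$ such that every control $\mu$ in the class of admissible stationary controls generates an irreducible (Harris) process with $$\mathcal G^\mu V(x)\le -W(x)+b\,\mathbf 1_C(x),\qquad x\in\mathcal S,$$ and $0\le c(x,u)\le W(x)$ for all $(x,u)$. Ergodic control value: $$g^{\mathrm{erg}}=\inf_\mu\ \limsup_{T\to\infty}\frac1T\,\mathbb E\Big[\int_0^Tc(Q(s),\mu(Q(s)))\,ds\Big],$$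 the infimum over admissible stationary controls $\mu$, with $Q$ the process generated by $\mu$ started from an arbitrary fixed initial state. Self-transport value on $[0,T]$: $g_T(\tilde\pi)=\inf_\pi\int c(x,u)\,\pi(dt,dx,du)$ over measures $\pi$ on $[0,T]\times\mathcal S\times\mathcal U$ such that: (a) $\pi(dt,dx,du)=\pi_t(dx,du)\,dt$ with each $\pi_t$ a probability measure; (b) the state marginal $\pi_{1,t}(dx)=\int_{\mathcal U}\pi_t(dx,du)$ has a weakly continuous version with $\pi_{1,0}=\pi_{1,T}=\tilde\pi$; (c) for all $f:[0,T]\times\mathcal S\to\mathbb R$ with $f,\partial_tf$ bounded and uniformly continuous, $\int(f(T,x)-f(0,x))\,\tilde\pi(dx)=\int\{\partial_tf+\mathcal G^uf\}\,d\pi$; (d) $\int(1+V(x))\,\pi(dt,dx,du)<\infty$. The infimum over the empty set is $+\infty$. *)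

theory Defs
  imports "HOL-Probability.Probability"
begin

text \<open>
  The state space is a type \<open>'s discrete\<close> with \<open>'s\<close> countable: it carries the discrete topology
  and the discrete metric, and probability measures on it are \<open>'s discrete pmf\<close>.  The control
  space is a set \<open>U\<close> in a Euclidean space.  The jump-rate kernel is \<open>q x u\<close>, a measure on the
  states; only the arguments \<open>u \<in> U\<close> are meaningful.  A possible atom of \<open>q x u\<close> at \<open>x\<close> is
  allowed; it does not contribute to the generator.
\<close>

definition lower_semicontinuous_on :: "'a::topological_space set \<Rightarrow> ('a \<Rightarrow> real) \<Rightarrow> bool" where
  "lower_semicontinuous_on A f \<longleftrightarrow>
     (\<forall>a\<in>A. \<forall>r<f a. eventually (\<lambda>b. r < f b) (at a within A))"

definition affine_on :: "'a::real_vector set \<Rightarrow> ('a \<Rightarrow> real) \<Rightarrow> bool" where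
  "affine_on A f \<longleftrightarrow>
     (\<forall>a\<in>A. \<forall>b\<in>A. \<forall>t\<in>{0..1}. f ((1 - t) *\<^sub>R a + t *\<^sub>R b) = (1 - t) * f a + t * f b)"

definition relatively_compact_sublevels :: "('a::topological_space \<Rightarrow> real) \<Rightarrow> bool" where
  "relatively_compact_sublevels f \<longleftrightarrow> (\<forall>r. compact (closure {x. f x \<le> r}))"

definition jump_rate_kernel ::
    "'u::euclidean_space set \<Rightarrow> ('s::countable discrete \<Rightarrow> 'u \<Rightarrow> 's discrete measure) \<Rightarrow> bool" where
  "jump_rate_kernel U q \<longleftrightarrow>
     (\<forall>x. \<forall>u\<in>U. sets (q x u) = UNIV) \<and>
     (\<forall>A. (\<lambda>(x, u). emeasure (q x u) A)
            \<in> borel_measurable (count_space UNIV \<Otimes>\<^sub>M restrict_space borel U))"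

definition gen ::
    "('s discrete \<Rightarrow> 'u \<Rightarrow> 's discrete measure) \<Rightarrow> 'u \<Rightarrow> ('s discrete \<Rightarrow> real) \<Rightarrow> 's discrete \<Rightarrow> real" where
  "gen q u f x = (\<integral>y. (f y - f x) \<partial>q x u)"

definition gen_ctrl ::
    "('s discrete \<Rightarrow> 'u \<Rightarrow> 's discrete measure) \<Rightarrow> ('s discrete \<Rightarrow> 'u) \<Rightarrow>
     ('s discrete \<Rightarrow> real) \<Rightarrow> 's discrete \<Rightarrow> real" where
  "gen_ctrl q \<mu> f x = gen q (\<mu> x) f x"

text \<open>The common core: the linear span of the constants and the singleton indicators.\<close>

definition core :: "('s discrete \<Rightarrow> real) set" where
  "core = {f. \<exists>a F b. finite F \<and> f = (\<lambda>x. a + (\<Sum>y\<in>F. b y * indicator {y} x))}"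

subsection \<open>Markov jump processes with a given generator\<close>

text \<open>
  \<open>P t x\<close> is the law at time \<open>t\<close> of the process started at \<open>x\<close>.  The generator \<open>L\<close> is the
  derivative at \<open>0\<close> of the semigroup on the core, in the supremum norm of the bounded functions.
\<close>

definition semigroup_generated_by ::
    "(('s discrete \<Rightarrow> real) \<Rightarrow> 's discrete \<Rightarrow> real) \<Rightarrow>
     (real \<Rightarrow> 's discrete \<Rightarrow> 's discrete pmf) \<Rightarrow> bool" where
  "semigroup_generated_by L P \<longleftrightarrow>
     (\<forall>x. P 0 x = return_pmf x) \<and>
     (\<forall>s\<ge>0. \<forall>t\<ge>0. \<forall>x. P (s + t) x = bind_pmf (P s x) (P t)) \<and>
     (\<forall>f\<in>core. uniform_limit UNIV
        (\<lambda>t x. (measure_pmf.expectation (P t x) f - f x) / t) (L f) (at_right 0))"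

definition generates_irreducible :: "(('s discrete \<Rightarrow> real) \<Rightarrow> 's discrete \<Rightarrow> real) \<Rightarrow> bool" where
  "generates_irreducible L \<longleftrightarrow>
     (\<exists>P. semigroup_generated_by L P \<and> (\<forall>x y. \<exists>t>0. pmf (P t x) y > 0))"

definition invariant_law ::
    "(('s discrete \<Rightarrow> real) \<Rightarrow> 's discrete \<Rightarrow> real) \<Rightarrow> 's discrete pmf \<Rightarrow> bool" where
  "invariant_law L \<nu> \<longleftrightarrow>
     (\<exists>P. semigroup_generated_by L P \<and> (\<forall>t\<ge>0. bind_pmf \<nu> (P t) = \<nu>))"

definition natural_filtration ::
    "'w measure \<Rightarrow> (real \<Rightarrow> 'w \<Rightarrow> 's) \<Rightarrow> real \<Rightarrow> 'w measure" where
  "natural_filtration M X s =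
     sigma (space M) {X r -` B \<inter> space M | r B. 0 \<le> r \<and> r \<le> s}"

definition markov_jump_process ::
    "(('s::countable discrete \<Rightarrow> real) \<Rightarrow> 's discrete \<Rightarrow> real) \<Rightarrow> 's discrete \<Rightarrow>
     'w measure \<Rightarrow> (real \<Rightarrow> 'w \<Rightarrow> 's discrete) \<Rightarrow> bool" where
  "markov_jump_process L x0 M X \<longleftrightarrow>
     prob_space M \<and>
     (\<forall>t\<ge>0. X t \<in> measurable M (count_space UNIV)) \<and>
     (AE \<omega> in M. X 0 \<omega> = x0) \<and>
     (\<forall>\<omega>\<in>space M.
        (\<forall>t\<ge>0. continuous (at_right t) (\<lambda>s. X s \<omega>)) \<and>
        (\<forall>t>0. \<exists>l. ((\<lambda>s. X s \<omega>) \<longlongrightarrow> l) (at_left t))) \<and>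
     (\<exists>P. semigroup_generated_by L P \<and>
        (\<forall>s t y. 0 \<le> s \<and> s \<le> t \<longrightarrow>
          (AE \<omega> in M. real_cond_exp M (natural_filtration M X s)
                         (\<lambda>\<omega>. indicator {y} (X t \<omega>)) \<omega> = pmf (P (t - s) (X s \<omega>)) y)))"

subsection \<open>The ergodic control value\<close>

definition long_run_cost ::
    "('s discrete \<Rightarrow> 'u \<Rightarrow> real) \<Rightarrow> ('s discrete \<Rightarrow> 'u) \<Rightarrow>
     'w measure \<Rightarrow> (real \<Rightarrow> 'w \<Rightarrow> 's discrete) \<Rightarrow> ereal" where
  "long_run_cost c \<mu> M X =
     Limsup at_top (\<lambda>T::real. ereal (1 / T) *
       enn2ereal (\<integral>\<^sup>+\<omega>. (\<integral>\<^sup>+s\<in>{0..T}. ennreal (c (X s \<omega>) (\<mu> (X s \<omega>))) \<partial>lborel) \<partial>M))"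

text \<open>\<open>M \<mu>\<close> and \<open>X \<mu>\<close> are the probability space and the process belonging to the control \<open>\<mu>\<close>.\<close>

definition ergodic_control_value ::
    "('s discrete \<Rightarrow> 'u) set \<Rightarrow> ('s discrete \<Rightarrow> 'u \<Rightarrow> real) \<Rightarrow>
     (('s discrete \<Rightarrow> 'u) \<Rightarrow> 'w measure) \<Rightarrow>
     (('s discrete \<Rightarrow> 'u) \<Rightarrow> real \<Rightarrow> 'w \<Rightarrow> 's discrete) \<Rightarrow> ereal" where
  "ergodic_control_value A c M X = (INF \<mu>\<in>A. long_run_cost c \<mu> (M \<mu>) (X \<mu>))"

subsection \<open>The self-transport problem\<close>

abbreviation state_control_space :: "'u::euclidean_space set \<Rightarrow> ('s discrete \<times> 'u) measure" where
  "state_control_space U \<equiv> count_space UNIV \<Otimes>\<^sub>M restrict_space borel U"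

definition test_function ::
    "real \<Rightarrow> (real \<Rightarrow> 's discrete \<Rightarrow> real) \<Rightarrow> (real \<Rightarrow> 's discrete \<Rightarrow> real) \<Rightarrow> bool" where
  "test_function T f f' \<longleftrightarrow>
     (\<forall>t\<in>{0..T}. \<forall>x. ((\<lambda>s. f s x) has_real_derivative f' t x) (at t within {0..T})) \<and>
     (\<forall>g\<in>{f, f'}. bounded ((\<lambda>(t, x). g t x) ` ({0..T} \<times> UNIV)) \<and>
        uniformly_continuous_on ({0..T} \<times> UNIV) (\<lambda>(t, x). g t x))"

text \<open>
  In the next definition \<open>k\<close> is the disintegration of \<open>\<pi>\<close> in time, and \<open>m\<close> the weakly continuous
  version of the flow of state marginals.
\<close>

definition self_transport_plan ::
    "'u::euclidean_space set \<Rightarrow> ('s::countable discrete \<Rightarrow> 'u \<Rightarrow> 's discrete measure) \<Rightarrow>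
     ('s discrete \<Rightarrow> real) \<Rightarrow> real \<Rightarrow> 's discrete pmf \<Rightarrow>
     (real \<times> 's discrete \<times> 'u) measure \<Rightarrow> bool" where
  "self_transport_plan U q V T \<nu> \<pi> \<longleftrightarrow>
     sets \<pi> = sets (restrict_space lborel {0..T} \<Otimes>\<^sub>M state_control_space U) \<and>
     (\<exists>k m.
        k \<in> measurable (restrict_space lborel {0..T}) (prob_algebra (state_control_space U)) \<and>
        (\<forall>B\<in>sets \<pi>. emeasure \<pi> B =
           (\<integral>\<^sup>+t. emeasure (k t) (Pair t -` B) \<partial>restrict_space lborel {0..T})) \<and>
        (AE t in restrict_space lborel {0..T}.
           distr (k t) (count_space UNIV) fst = measure_pmf (m t)) \<and>
        (\<forall>\<phi>::'s discrete \<Rightarrow> real. continuous_on UNIV \<phi> \<and> bounded (range \<phi>) \<longrightarrow>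
           continuous_on {0..T} (\<lambda>t. measure_pmf.expectation (m t) \<phi>)) \<and>
        m 0 = \<nu> \<and> m T = \<nu>) \<and>
     (\<forall>f f'. test_function T f f' \<longrightarrow>
        measure_pmf.expectation \<nu> (\<lambda>x. f T x - f 0 x) =
          (\<integral>(t, x, u). (f' t x + gen q u (f t) x) \<partial>\<pi>)) \<and>
     (\<integral>\<^sup>+(t, x, u). ennreal (1 + V x) \<partial>\<pi>) < \<infinity>"

text \<open>The infimum is taken in the extended reals, so it is \<open>\<infinity>\<close> if there is no plan.\<close>

definition self_transport_value ::
    "'u::euclidean_space set \<Rightarrow> ('s::countable discrete \<Rightarrow> 'u \<Rightarrow> 's discrete measure) \<Rightarrow>
     ('s discrete \<Rightarrow> real) \<Rightarrow> ('s discrete \<Rightarrow> 'u \<Rightarrow> real) \<Rightarrow> real \<Rightarrow> 's discrete pmf \<Rightarrow> ereal" where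
  "self_transport_value U q V c T \<nu> =
     (INF \<pi>\<in>Collect (self_transport_plan U q V T \<nu>).
        enn2ereal (\<integral>\<^sup>+(t, x, u). ennreal (c x u) \<partial>\<pi>))"

end

theory Submission
  imports Defs
begin

text \<open>
  The rates are bounded, so every controlled process is a discrete chain \<open>K\<close> run at the jump times of
  a Poisson process of one fixed rate \<open>\<Lambda>\<close>: its generator is \<open>\<Lambda> (K - I)\<close>, and an abstract semigroup
  with this generator is forced to be the Poisson mixture of the powers of \<open>K\<close>
  (\<open>uniformization\<close>, \<open>semigroup_eq_poisson\<close>).  Existence of invariant laws, moment bounds and the
  expected running cost thereby become statements about \<open>K\<close>, where no stopping times or Dynkin
  formula for unbounded functions are involved.

  The value \<open>g*\<close> comes from one inequality.  Since \<open>ustar x\<close> maximizes \<open>gen q u h x - c x u\<close>, the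
  optimality equation says \<open>g* + gen q u h x \<le> c x u\<close> for all \<open>u\<close>, with equality at \<open>u = ustar x\<close>.

  For a self-transport plan the marginals at \<open>0\<close> and \<open>T\<close> agree, so \<open>gen q u f x\<close> integrates to \<open>0\<close>
  for bounded \<open>f\<close>, and, by truncation and the integrability of \<open>V\<close>, also for \<open>f = h\<close>.  Integrating the
  inequality gives cost at least \<open>T g*\<close> (\<open>transport_cost_ge\<close>).  Conversely let \<open>\<nu>\<close> be the invariant law
  of the process generated by \<open>ustar\<close>; freezing the process at \<open>\<nu>\<close> gives a plan of cost at most \<open>T g*\<close>
  (\<open>stationary_plan\<close>).  The law \<open>\<nu>\<close> exists by Foster's criterion (\<open>foster_invariant\<close>), with a constant
  minus \<open>h\<close> as Lyapunov function: its drift is \<open>g* - c x (ustar x)\<close>, which is at most \<open>-1\<close> outside a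
  finite set because the cost is coercive.

  For the control problem let \<open>\<Psi> \<ge> 0\<close> be a constant minus \<open>h\<close>.  Summing the inequality along the chain
  shows that the expectation of the accumulated cost plus \<open>\<Psi>\<close> at the current state grows by at least
  \<open>g*\<close> per unit of time, and by exactly \<open>g*\<close> under \<open>ustar\<close>.  Under \<open>ustar\<close> this bounds the cost from above since
  \<open>\<Psi> \<ge> 0\<close>.  Under any other control the bound from below needs the expectation of \<open>\<Psi>\<close> to stay
  bounded in time.  This holds because the chain started at \<open>x\<close> is dominated by the chain started
  from its invariant law \<open>\<nu>\<close>: the expectation of \<open>\<Psi>\<close> is at most \<open>\<nu>(\<Psi>) / \<nu>(x)\<close>
  (\<open>kernel_power_moment\<close>), where \<open>\<nu>(\<Psi>)\<close> is finite as \<open>\<Psi>\<close> grows at most like \<open>V\<close>, and \<open>\<nu>(x) > 0\<close> by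
  irreducibility.
\<close>

section \<open>Invariant laws of countable Markov chains\<close>

primrec kernel_power :: "('a \<Rightarrow> 'a pmf) \<Rightarrow> nat \<Rightarrow> 'a \<Rightarrow> 'a pmf" where
  "kernel_power K 0 x = return_pmf x"
| "kernel_power K (Suc n) x = bind_pmf (kernel_power K n x) K"

lemma pmf_eqI_le: "(\<And>x. pmf p x \<le> pmf q x) \<Longrightarrow> p = q"
  using pmf_neq_exists_less[of q p] by (metis linorder_not_le)

lemma pointwise_convergent_subsequence:
  fixes f :: "nat \<Rightarrow> 'a::countable \<Rightarrow> real"
  assumes "\<And>n x. 0 \<le> f n x" "\<And>n x. f n x \<le> 1"
  obtains r \<nu> where "strict_mono (r::nat \<Rightarrow> nat)" "\<And>x. (\<lambda>n. f (r n) x) \<longlonglongrightarrow> \<nu> x"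
proof -
  have "compactin (product_topology (\<lambda>_::'a. euclideanreal) UNIV) (PiE UNIV (\<lambda>_. {0..1}))"
    by (simp add: compactin_PiE)
  then have "seq_compact (PiE UNIV (\<lambda>_::'a. {0..1::real}))"
    by (simp add: euclidean_product_topology compact_eq_seq_compact_metric)
  moreover have "\<forall>n. f n \<in> PiE UNIV (\<lambda>_. {0..1})" using assms by auto
  ultimately obtain \<nu> r where "strict_mono (r::nat \<Rightarrow> nat)" "(f \<circ> r) \<longlonglongrightarrow> \<nu>"
    unfolding seq_compact_def by metis
  moreover have "isCont (\<lambda>g::'a \<Rightarrow> real. g x) \<nu>" for x
    by (rule continuous_on_interior[OF continuous_on_product_coordinates]) simp
  ultimately show thesis
    using that[of r \<nu>] isCont_tendsto_compose[of \<nu> "\<lambda>g. g _" "f \<circ> r"] by (simp add: o_def)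
qed

lemma pmf_bind_count_space:
  "ennreal (pmf (bind_pmf p K) y) = (\<integral>\<^sup>+x. ennreal (pmf p x * pmf (K x) y) \<partial>count_space UNIV)"
  by (simp add: ennreal_pmf_bind nn_integral_measure_pmf ennreal_mult)

text \<open>
  Foster's criterion.  The drift inequality forces the chain to spend a positive fraction of its time
  in the finite set \<open>C\<close>, so a pointwise limit of the averaged laws is not zero.  Mass may escape to
  infinity in this limit, and Fatou's lemma only makes it subinvariant.  A subinvariant measure of
  finite mass is invariant, because a Markov kernel preserves the total mass; so no tightness is
  needed, and the limit can be normalized.
\<close>

lemma foster_invariant:
  fixes K :: "'a::countable \<Rightarrow> 'a pmf" and \<Psi> :: "'a \<Rightarrow> real"
  assumes \<Psi>: "\<And>x. 0 \<le> \<Psi> x" and \<epsilon>: "0 < \<epsilon>" and C: "finite C" and b: "0 \<le> b"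
    and drift: "\<And>x. (\<integral>\<^sup>+y. ennreal (\<Psi> y) \<partial>K x) + ennreal \<epsilon>
                  \<le> ennreal (\<Psi> x) + ennreal b * indicator C x"
  obtains \<nu> where "bind_pmf \<nu> K = \<nu>"
proof -
  \<comment> \<open>Any starting state will do.\<close>
  define x0 :: 'a where "x0 = undefined"
  define p where "p k = kernel_power K k x0" for k
  define e where "e k = (\<integral>\<^sup>+y. ennreal (\<Psi> y) \<partial>p k)" for k
  have pS: "p (Suc k) = bind_pmf (p k) K" for k by (simp add: p_def)
  have e_step: "e (Suc k) + ennreal \<epsilon> \<le> e k + ennreal b * emeasure (p k) C" for k
  proof -
    have "e (Suc k) + ennreal \<epsilon> = (\<integral>\<^sup>+x. (\<integral>\<^sup>+y. ennreal (\<Psi> y) \<partial>K x) + ennreal \<epsilon> \<partial>p k)"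
      by (simp add: e_def pS nn_integral_add)
    also have "\<dots> \<le> (\<integral>\<^sup>+x. ennreal (\<Psi> x) + ennreal b * indicator C x \<partial>p k)"
      by (intro nn_integral_mono drift)
    also have "\<dots> = e k + ennreal b * emeasure (p k) C"
      by (simp add: e_def nn_integral_add nn_integral_cmult)
    finally show ?thesis .
  qed
  have "e n + ennreal (real n * \<epsilon>) \<le> ennreal (\<Psi> x0) + (\<Sum>k<n. ennreal b * emeasure (p k) C)" for n
  proof (induction n)
    case 0
    then show ?case by (simp add: e_def p_def)
  next
    case (Suc n)
    have "e (Suc n) + ennreal (real (Suc n) * \<epsilon>) = e (Suc n) + ennreal \<epsilon> + ennreal (real n * \<epsilon>)"
      using \<epsilon> by (simp add: algebra_simps ennreal_plus)
    also have "\<dots> \<le> e n + ennreal b * emeasure (p n) C + ennreal (real n * \<epsilon>)"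
      by (intro add_right_mono e_step)
    also have "\<dots> = e n + ennreal (real n * \<epsilon>) + ennreal b * emeasure (p n) C"
      by (simp add: ac_simps)
    also have "\<dots> \<le> ennreal (\<Psi> x0) + (\<Sum>k<n. ennreal b * emeasure (p k) C)
        + ennreal b * emeasure (p n) C"
      by (intro add_right_mono Suc)
    finally show ?case by (simp add: ac_simps)
  qed
  then have "ennreal (real n * \<epsilon>) \<le> ennreal (\<Psi> x0) + (\<Sum>k<n. ennreal b * emeasure (p k) C)" for n
    by (rule order_trans[rotated]) (simp add: add_increasing)
  also have "ennreal (\<Psi> x0) + (\<Sum>k<n. ennreal b * emeasure (p k) C)
      = ennreal (\<Psi> x0 + b * (\<Sum>k<n. \<Sum>y\<in>C. pmf (p k) y))" for n
    using b \<Psi> by (simp add: measure_pmf.emeasure_eq_measure measure_measure_pmf_finite[OF C]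
        ennreal_mult[symmetric] sum_nonneg sum_ennreal sum_distrib_left ennreal_plus)
  finally have occ: "real n * \<epsilon> \<le> \<Psi> x0 + b * (\<Sum>k<n. \<Sum>y\<in>C. pmf (p k) y)" for n
    using b \<Psi> by (subst (asm) ennreal_le_iff) (auto intro!: add_nonneg_nonneg mult_nonneg_nonneg sum_nonneg)
  \<comment> \<open>The averaged laws of the first \<open>n + 1\<close> steps; the shift avoids an empty average.\<close>
  define avg where "avg n y = (\<Sum>k<Suc n. pmf (p k) y) / real (Suc n)" for n y
  have avg0: "0 \<le> avg n y" for n y by (simp add: avg_def sum_nonneg del: sum.lessThan_Suc)
  have avg1: "avg n y \<le> 1" for n y
    using sum_mono[of "{..<Suc n}" "\<lambda>k. pmf (p k) y" "\<lambda>_. 1"] pmf_le_1[of _ y]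
    by (simp add: avg_def divide_simps)
  obtain r \<nu> where r: "strict_mono (r::nat\<Rightarrow>nat)" and lim: "\<And>y. (\<lambda>n. avg (r n) y) \<longlonglongrightarrow> \<nu> y"
    using pointwise_convergent_subsequence[of avg, OF avg0 avg1] by blast
  have \<nu>0: "0 \<le> \<nu> y" for y
    using lim[of y] by (rule LIMSEQ_le_const) (auto simp: avg0)
  have inv0: "(\<lambda>n. c / real (Suc (r n))) \<longlonglongrightarrow> 0" for c
    using LIMSEQ_subseq_LIMSEQ[OF LIMSEQ_Suc[OF lim_const_over_n[of c]] r] by (simp add: o_def)
  have "\<epsilon> \<le> b * (\<Sum>y\<in>C. \<nu> y)"
  proof (rule LIMSEQ_le)
    show "(\<lambda>n. \<epsilon> - \<Psi> x0 / real (Suc (r n))) \<longlonglongrightarrow> \<epsilon>"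
      using tendsto_diff[OF tendsto_const inv0, of \<epsilon> "\<Psi> x0"] by simp
    show "(\<lambda>n. b * (\<Sum>y\<in>C. avg (r n) y)) \<longlonglongrightarrow> b * (\<Sum>y\<in>C. \<nu> y)"
      by (intro tendsto_intros lim)
    have "\<epsilon> - \<Psi> x0 / real (Suc n) \<le> b * (\<Sum>y\<in>C. avg n y)" for n
    proof -
      have "(\<Sum>y\<in>C. avg n y) = (\<Sum>k<Suc n. \<Sum>y\<in>C. pmf (p k) y) / real (Suc n)"
        unfolding avg_def sum_divide_distrib[symmetric] by (subst sum.swap) rule
      then show ?thesis
        using occ[of "Suc n"] by (simp add: field_simps del: sum.lessThan_Suc)
    qed
    then show "\<exists>N. \<forall>n\<ge>N. \<epsilon> - \<Psi> x0 / real (Suc (r n)) \<le> b * (\<Sum>y\<in>C. avg (r n) y)" by blast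
  qed
  then obtain y0 where y0: "\<nu> y0 > 0"
    using \<epsilon> \<nu>0 b by (metis linorder_not_le mult_nonneg_nonpos order_trans sum_nonpos)
  \<comment> \<open>Fatou: upper bounds on integrals of the averages pass to the limit \<open>\<nu>\<close>.\<close>
  have sub: "(\<integral>\<^sup>+x. ennreal (\<nu> x * \<kappa> x) \<partial>count_space UNIV) \<le> ennreal l"
    if \<kappa>: "\<And>x. 0 \<le> \<kappa> x" and l: "l' \<longlonglongrightarrow> l"
      and bd: "\<And>n. (\<integral>\<^sup>+x. ennreal (avg (r n) x * \<kappa> x) \<partial>count_space UNIV) \<le> ennreal (l' n)" for \<kappa> l l'
  proof -
    have "(\<integral>\<^sup>+x. ennreal (\<nu> x * \<kappa> x) \<partial>count_space UNIV)
        = (\<integral>\<^sup>+x. liminf (\<lambda>n. ennreal (avg (r n) x * \<kappa> x)) \<partial>count_space UNIV)"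
      by (intro nn_integral_cong lim_imp_Liminf[symmetric] tendsto_intros lim) auto
    also have "\<dots> \<le> liminf (\<lambda>n. \<integral>\<^sup>+x. ennreal (avg (r n) x * \<kappa> x) \<partial>count_space UNIV)"
      by (rule nn_integral_liminf) auto
    also have "\<dots> \<le> liminf (\<lambda>n. ennreal (l' n))"
      by (intro Liminf_mono) (auto simp: bd)
    also have "\<dots> = ennreal l"
      using l by (intro lim_imp_Liminf tendsto_intros) auto
    finally show ?thesis .
  qed
  have avg_int: "(\<integral>\<^sup>+x. ennreal (avg n x * \<kappa> x) \<partial>count_space UNIV)
      = (\<Sum>k<Suc n. \<integral>\<^sup>+x. ennreal (pmf (p k) x * \<kappa> x) \<partial>count_space UNIV) * ennreal (1 / real (Suc n))"
    if \<kappa>: "\<And>x. 0 \<le> \<kappa> x" for n \<kappa>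
  proof -
    have "(\<integral>\<^sup>+x. ennreal (avg n x * \<kappa> x) \<partial>count_space UNIV)
      = (\<integral>\<^sup>+x. (\<Sum>k<Suc n. ennreal (pmf (p k) x * \<kappa> x)) * ennreal (1 / real (Suc n)) \<partial>count_space UNIV)"
      using \<kappa> by (intro nn_integral_cong)
        (simp add: avg_def sum_ennreal ennreal_mult[symmetric] sum_nonneg sum_distrib_right
          del: sum.lessThan_Suc)
    also have "\<dots> = (\<Sum>k<Suc n. \<integral>\<^sup>+x. ennreal (pmf (p k) x * \<kappa> x) \<partial>count_space UNIV) * ennreal (1 / real (Suc n))"
      by (subst nn_integral_multc) (simp_all only: nn_integral_sum borel_measurable_count_space)
    finally show ?thesis .
  qed
  have subinv: "(\<integral>\<^sup>+x. ennreal (\<nu> x * pmf (K x) y) \<partial>count_space UNIV) \<le> ennreal (\<nu> y)" for y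
  proof (rule sub)
    show "(\<lambda>n. avg (r n) y + 1 / real (Suc (r n))) \<longlonglongrightarrow> \<nu> y"
      using tendsto_add[OF lim[of y] inv0[of 1]] by simp
    fix n
    have "(\<Sum>k<Suc m. pmf (p (Suc k)) y) = (\<Sum>k<Suc m. pmf (p k) y) - pmf (p 0) y + pmf (p (Suc m)) y" for m
      using sum.lessThan_Suc_shift[of "\<lambda>k. pmf (p k) y" "Suc m"] by simp
    then have shift: "(\<Sum>k<Suc m. pmf (p (Suc k)) y) \<le> (\<Sum>k<Suc m. pmf (p k) y) + 1" for m
      using pmf_le_1[of "p (Suc m)" y] pmf_nonneg[of "p 0" y] by (smt (verit))
    have "(\<integral>\<^sup>+x. ennreal (avg (r n) x * pmf (K x) y) \<partial>count_space UNIV)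
        = (\<Sum>k<Suc (r n). ennreal (pmf (p (Suc k)) y)) * ennreal (1 / real (Suc (r n)))"
      unfolding pS pmf_bind_count_space by (rule avg_int) simp
    also have "\<dots> = ennreal ((\<Sum>k<Suc (r n). pmf (p (Suc k)) y) * (1 / real (Suc (r n))))"
      by (simp add: sum_ennreal ennreal_mult[symmetric] sum_nonneg del: sum.lessThan_Suc)
    also have "\<dots> \<le> ennreal (avg (r n) y + 1 / real (Suc (r n)))"
      using shift[of "r n"] by (intro ennreal_leI) (simp add: avg_def divide_simps del: sum.lessThan_Suc)
    finally show "(\<integral>\<^sup>+x. ennreal (avg (r n) x * pmf (K x) y) \<partial>count_space UNIV)
        \<le> ennreal (avg (r n) y + 1 / real (Suc (r n)))" .
  qed simp
  define m where "m = (\<integral>\<^sup>+x. ennreal (\<nu> x) \<partial>count_space UNIV)"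
  have "(\<integral>\<^sup>+x. ennreal (\<nu> x * 1) \<partial>count_space UNIV) \<le> ennreal 1"
  proof (rule sub)
    fix n
    have "(\<integral>\<^sup>+x. ennreal (pmf (p k) x) \<partial>count_space UNIV) = 1" for k
      by (simp add: nn_integral_pmf)
    then have "(\<integral>\<^sup>+x. ennreal (avg (r n) x * 1) \<partial>count_space UNIV)
        = of_nat (Suc (r n)) * ennreal (1 / real (Suc (r n)))"
      by (subst avg_int) (simp_all del: sum.lessThan_Suc of_nat_Suc)
    also have "\<dots> = ennreal 1"
      by (subst ennreal_of_nat_eq_real_of_nat, subst ennreal_mult[symmetric]) auto
    finally show "(\<integral>\<^sup>+x. ennreal (avg (r n) x * 1) \<partial>count_space UNIV) \<le> ennreal 1" by simp
  qed auto
  then have m1: "m \<le> 1" by (simp add: m_def)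
  have "ennreal (\<nu> y0) \<le> m"
    using nn_integral_mono[of "count_space UNIV" "\<lambda>x. ennreal (\<nu> y0) * indicator {y0} x" "\<lambda>x. ennreal (\<nu> x)"]
    by (simp add: m_def nn_integral_cmult split: split_indicator)
  then obtain m' where m': "m = ennreal m'" "0 < m'"
    using y0 m1 by (metis ennreal_cases ennreal_le_iff ennreal_one_neq_top le_less_trans less_le_trans
        neq_top_trans not_less top.not_eq_extremum)
  define pm where "pm = embed_pmf (\<lambda>y. \<nu> y / m')"
  have "(\<integral>\<^sup>+x. ennreal (\<nu> x / m') \<partial>count_space UNIV) = m * ennreal (1 / m')"
    unfolding m_def using m'(2) \<nu>0
    by (subst nn_integral_multc[symmetric]) (auto simp: ennreal_mult[symmetric])
  then have pm: "pmf pm y = \<nu> y / m'" for y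
    unfolding pm_def using m' \<nu>0 by (intro pmf_embed_pmf) (auto simp: ennreal_mult[symmetric])
  have "pmf (bind_pmf pm K) y \<le> pmf pm y" for y
  proof -
    have "ennreal (pmf (bind_pmf pm K) y) = (\<integral>\<^sup>+x. ennreal (\<nu> x * pmf (K x) y) \<partial>count_space UNIV) * ennreal (1 / m')"
      unfolding pmf_bind_count_space pm using m'(2) \<nu>0
      by (subst nn_integral_multc[symmetric]) (auto simp: ennreal_mult[symmetric])
    also have "\<dots> \<le> ennreal (\<nu> y) * ennreal (1 / m')"
      by (intro mult_right_mono subinv) auto
    also have "\<dots> = ennreal (pmf pm y)"
      using m'(2) \<nu>0 by (simp add: pm ennreal_mult[symmetric])
    finally show ?thesis by simp
  qed
  then show thesis by (intro that[of pm] pmf_eqI_le)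
qed

section \<open>Semigroups with bounded rates\<close>

text \<open>
  Monotonicity from a one-sided derivative bound.  The generator controls increments of the semigroup
  only to the right of each time, so the usual criterion with two-sided derivatives does not apply.
\<close>

lemma dini_monotone:
  fixes g :: "real \<Rightarrow> real"
  assumes T: "0 \<le> T" and cont: "continuous_on {0..T} g"
    and dini: "\<And>t e. 0 \<le> t \<Longrightarrow> t < T \<Longrightarrow> 0 < e \<Longrightarrow> \<forall>\<^sub>F s in at_right 0. g t - e * s \<le> g (t + s)"
  shows "g 0 \<le> g T"
proof (rule field_le_epsilon)
  fix e :: real assume e: "0 < e"
  define e' where "e' = e / (T + 1)"
  have e': "0 < e'" "e' * T \<le> e" using e T by (auto simp: e'_def field_simps)
  define \<phi> where "\<phi> t = g t + e' * t" for t
  define A where "A = {t\<in>{0..T}. \<phi> 0 \<le> \<phi> t}"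
  have cont\<phi>: "continuous_on {0..T} \<phi>"
    unfolding \<phi>_def by (intro continuous_intros cont)
  have "closed A"
    unfolding A_def by (intro continuous_on_closed_Collect_le cont\<phi> continuous_intros)
  have "bdd_above A" "0 \<in> A" using T by (auto simp: A_def)
  then have sup: "Sup A \<in> A" using \<open>closed A\<close> closed_contains_Sup by blast
  show "g 0 \<le> g T + e"
  proof (cases "Sup A = T")
    case True
    then show ?thesis using sup e' by (auto simp: A_def \<phi>_def)
  next
    case False
    then have lt: "0 \<le> Sup A" "Sup A < T" using sup by (auto simp: A_def)
    have "\<forall>\<^sub>F s in at_right 0. s < T - Sup A \<and> 0 < s \<and> g (Sup A) - e' * s \<le> g (Sup A + s)"
      using dini[OF lt e'(1)] eventually_at_right_real[of 0 "T - Sup A"] lt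
      by (auto simp: eventually_conj_iff)
    then obtain s where s: "s < T - Sup A" "0 < s" "g (Sup A) - e' * s \<le> g (Sup A + s)"
      using eventually_happens[of _ "at_right (0::real)"] by (auto simp: trivial_limit_at_right_real)
    then have "Sup A + s \<in> A" using sup by (auto simp: A_def \<phi>_def algebra_simps)
    then show ?thesis using cSup_upper[OF _ \<open>bdd_above A\<close>] s by force
  qed
qed

lemma has_real_derivative_poisson_term:
  "((\<lambda>t. (\<Lambda> * t) ^ Suc n / fact (Suc n)) has_real_derivative \<Lambda> * ((\<Lambda> * t) ^ n / fact n)) (at t)"
proof -
  have "((\<lambda>t. \<Lambda> * t) has_real_derivative \<Lambda>) (at t)"
    by (auto intro!: derivative_eq_intros)
  from DERIV_cdivide[OF DERIV_power_Suc[OF this, of n], of "fact (Suc n)"]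
  show ?thesis
    by (rule DERIV_cong) (simp add: field_simps flip: of_nat_Suc)
qed

text \<open>
  Uniqueness of the semigroup.  Only the action of the generator on indicators of points is given, so
  the forward equation is available for each \<open>pmf (P t x) y\<close> separately.  The partial sums of the
  Poisson mixture lie below \<open>pmf (P t x) y\<close>: by induction on the number of terms, the difference
  multiplied by \<open>exp (\<Lambda> t)\<close> starts at \<open>0\<close> and has a nonnegative right derivative.  Both sides of the
  resulting inequality are probability laws, and therefore they are equal.
\<close>

lemma semigroup_eq_poisson:
  fixes K :: "'s::countable discrete \<Rightarrow> 's discrete pmf"
  assumes gen: "semigroup_generated_by L P" and \<Lambda>: "0 < \<Lambda>"
    and L: "\<And>y x. L (indicator {y}) x = \<Lambda> * (pmf (K x) y - indicator {y} x)"
    and t: "0 < t"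
  shows "P t x = bind_pmf (poisson_pmf (\<Lambda> * t)) (\<lambda>n. kernel_power K n x)"
proof -
  have P0: "P 0 x = return_pmf x" for x
    using gen by (auto simp: semigroup_generated_by_def)
  have PS: "0 \<le> s \<Longrightarrow> 0 \<le> t \<Longrightarrow> P (s + t) x = bind_pmf (P s x) (P t)" for s t x
    using gen by (auto simp: semigroup_generated_by_def)
  define p where "p t y = pmf (P t x) y" for t y
  define r where "r t y = pmf (bind_pmf (P t x) K) y" for t y
  have p01: "0 \<le> p t y" "p t y \<le> 1" "0 \<le> r t y" "r t y \<le> 1" for t y
    by (auto simp: p_def r_def pmf_le_1)
  \<comment> \<open>The forward equation with an error that is uniform in the starting time \<open>t\<close>.\<close>
  have deriv: "\<forall>\<^sub>F s in at_right 0. 0 < s \<and>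
      (\<forall>t\<ge>0. \<bar>p (t + s) y - p t y - s * (\<Lambda> * (r t y - p t y))\<bar> \<le> e * s)" if e: "0 < e" for y e
  proof -
    have "indicator {y} \<in> core"
      unfolding core_def by (intro CollectI exI[of _ 0] exI[of _ "{y}"] exI[of _ "\<lambda>_. 1"]) auto
    then have "uniform_limit UNIV (\<lambda>t x. (pmf (P t x) y - indicator {y} x) / t) (L (indicator {y})) (at_right 0)"
      using gen unfolding semigroup_generated_by_def by (auto simp: measure_pmf_single dest!: bspec)
    then have "\<forall>\<^sub>F s in at_right 0. \<forall>z. dist ((pmf (P s z) y - indicator {y} z) / s) (L (indicator {y}) z) < e"
      using e unfolding uniform_limit_iff by auto
    moreover have "\<forall>\<^sub>F s in at_right 0. (0::real) < s" by (rule eventually_at_right_less)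
    ultimately show ?thesis
    proof eventually_elim
      case (elim s)
      have pw: "\<bar>pmf (P s z) y - indicator {y} z - s * (\<Lambda> * (pmf (K z) y - indicator {y} z))\<bar> \<le> e * s" for z
      proof -
        have "\<bar>(pmf (P s z) y - indicator {y} z) / s - \<Lambda> * (pmf (K z) y - indicator {y} z)\<bar> * s \<le> e * s"
          using elim by (intro mult_right_mono) (auto simp: dist_real_def L less_imp_le)
        moreover have "pmf (P s z) y - indicator {y} z - s * (\<Lambda> * (pmf (K z) y - indicator {y} z))
            = ((pmf (P s z) y - indicator {y} z) / s - \<Lambda> * (pmf (K z) y - indicator {y} z)) * s"
          using elim(2) by (simp add: field_simps)
        ultimately show ?thesis using elim(2) by (simp only: abs_mult abs_of_pos)
      qed
      have "\<bar>p (t + s) y - p t y - s * (\<Lambda> * (r t y - p t y))\<bar> \<le> e * s" if "0 \<le> t" for t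
      proof -
        have int: "integrable (P t x) (\<lambda>z. pmf (Q z) y)" for Q :: "'s discrete \<Rightarrow> 's discrete pmf"
          by (intro measure_pmf.integrable_const_bound[of _ 1]) (auto simp: pmf_le_1)
        have int1: "integrable (P t x) (indicator {y} :: _ \<Rightarrow> real)"
          by (intro measure_pmf.integrable_const_bound[of _ 1]) auto
        have "p (t + s) y - p t y - s * (\<Lambda> * (r t y - p t y))
          = (\<integral>z. (pmf (P s z) y - indicator {y} z - s * (\<Lambda> * (pmf (K z) y - indicator {y} z))) \<partial>P t x)"
          using int int1 that elim(2) by (simp add: p_def r_def PS pmf_bind measure_pmf_single)
        also have "\<bar>\<dots>\<bar> \<le> (\<integral>z. e * s \<partial>P t x)"
          using pw int int1 by (intro order_trans[OF integral_abs_bound] integral_mono) auto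
        finally show ?thesis by simp
      qed
      with elim(2) show ?case by blast
    qed
  qed
  have cont: "continuous_on {0..} (\<lambda>t. p t y)" for y
  proof -
    obtain d where d: "0 < d" "\<And>s t. 0 < s \<Longrightarrow> s < d \<Longrightarrow> 0 \<le> t
        \<Longrightarrow> \<bar>p (t + s) y - p t y - s * (\<Lambda> * (r t y - p t y))\<bar> \<le> s"
      using deriv[of 1 y] unfolding eventually_at_right_field by auto
    have lip: "\<bar>p t y - p t' y\<bar> \<le> (\<Lambda> + 1) * \<bar>t - t'\<bar>" if "0 \<le> t" "0 \<le> t'" "\<bar>t - t'\<bar> < d" for t t'
    proof -
      have *: "\<bar>p (t + s) y - p t y\<bar> \<le> (\<Lambda> + 1) * s" if "0 < s" "s < d" "0 \<le> t" for t s
      proof -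
        have "\<bar>s * (\<Lambda> * (r t y - p t y))\<bar> \<le> s * (\<Lambda> * 1)"
          unfolding abs_mult using that \<Lambda> p01[of t y]
          by (intro mult_mono) auto
        with d(2)[OF that] show ?thesis by (simp add: algebra_simps)
      qed
      show ?thesis
        using *[of "t - t'" t'] *[of "t' - t" t] that
        by (cases "t = t'"; cases "t < t'") (auto simp: abs_minus_commute)
    qed
    show ?thesis
      unfolding continuous_on_iff
    proof (intro ballI allI impI)
      fix t e :: real assume t: "t \<in> {0..}" and e: "0 < e"
      show "\<exists>d>0. \<forall>x'\<in>{0..}. dist x' t < d \<longrightarrow> dist (p x' y) (p t y) < e"
      proof (intro exI[of _ "min d (e / (\<Lambda> + 1))"] conjI ballI impI)
        show "0 < min d (e / (\<Lambda> + 1))" using d(1) e \<Lambda> by simp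
        fix t' assume t': "t' \<in> {0..}" "dist t' t < min d (e / (\<Lambda> + 1))"
        then have "(\<Lambda> + 1) * \<bar>t' - t\<bar> < e"
          using \<Lambda> by (simp add: dist_real_def pos_less_divide_eq mult.commute)
        then show "dist (p t' y) (p t y) < e"
          using lip[of t' t] t t' by (simp add: dist_real_def)
      qed
    qed
  qed
  define S where "S N t y = (\<Sum>n<N. (\<Lambda> * t) ^ n / fact n * pmf (kernel_power K n x) y)" for N t y
  have lower: "exp (- (\<Lambda> * t)) * S N t y \<le> p t y" if "0 \<le> t" for t N y
    using that
  proof (induction N arbitrary: t y)
    case 0
    then show ?case by (simp add: S_def p01)
  next
    case (Suc N)
    define S' where "S' t = (\<Sum>n<N. (\<Lambda> * t) ^ n / fact n * pmf (kernel_power K (Suc n) x) y)" for t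
    \<comment> \<open>The gain term of the forward equation, bounded by applying \<open>K\<close> to the induction hypothesis.\<close>
    have r_ge: "exp (- (\<Lambda> * t)) * S' t \<le> r t y" if t: "0 \<le> t" for t
    proof -
      define w where "w n = exp (- (\<Lambda> * t)) * ((\<Lambda> * t) ^ n / fact n)" for n
      have w0: "0 \<le> w n" for n using t \<Lambda> by (simp add: w_def)
      have "exp (- (\<Lambda> * t)) * S' t = (\<Sum>n<N. w n * pmf (kernel_power K (Suc n) x) y)"
        unfolding S'_def sum_distrib_left w_def by (simp only: mult.assoc)
      then have "ennreal (exp (- (\<Lambda> * t)) * S' t)
        = (\<Sum>n<N. ennreal (w n) * ennreal (pmf (kernel_power K (Suc n) x) y))"
        using w0 by (simp add: sum_ennreal ennreal_mult[symmetric] del: kernel_power.simps)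
      also have "\<dots> = (\<Sum>n<N. \<integral>\<^sup>+z. ennreal (w n) * ennreal (pmf (kernel_power K n x) z * pmf (K z) y) \<partial>count_space UNIV)"
        by (simp add: pmf_bind_count_space nn_integral_cmult)
      also have "\<dots> = (\<integral>\<^sup>+z. (\<Sum>n<N. ennreal (w n) * ennreal (pmf (kernel_power K n x) z * pmf (K z) y)) \<partial>count_space UNIV)"
        by (rule nn_integral_sum[symmetric]) simp
      also have "\<dots> = (\<integral>\<^sup>+z. ennreal (exp (- (\<Lambda> * t)) * S N t z * pmf (K z) y) \<partial>count_space UNIV)"
      proof (rule nn_integral_cong)
        fix z
        have "exp (- (\<Lambda> * t)) * S N t z * pmf (K z) y
            = (\<Sum>n<N. w n * (pmf (kernel_power K n x) z * pmf (K z) y))"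
          unfolding S_def sum_distrib_left sum_distrib_right w_def by (simp only: mult.assoc)
        then show "(\<Sum>n<N. ennreal (w n) * ennreal (pmf (kernel_power K n x) z * pmf (K z) y))
            = ennreal (exp (- (\<Lambda> * t)) * S N t z * pmf (K z) y)"
          using w0 by (simp add: sum_ennreal ennreal_mult[symmetric])
      qed
      also have "\<dots> \<le> (\<integral>\<^sup>+z. ennreal (pmf (P t x) z * pmf (K z) y) \<partial>count_space UNIV)"
        using Suc.IH[OF t] by (intro nn_integral_mono ennreal_leI mult_right_mono) (auto simp: p_def)
      also have "\<dots> = ennreal (r t y)"
        by (simp add: r_def pmf_bind_count_space)
      finally show ?thesis using p01 by simp
    qed
    define g where "g t = exp (\<Lambda> * t) * p t y - S (Suc N) t y" for t
    have S_deriv: "((\<lambda>t. S (Suc N) t y) has_real_derivative \<Lambda> * S' t) (at t)" for t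
    proof -
      have "((\<lambda>t. (\<Lambda> * t) ^ Suc n / fact (Suc n) * c) has_real_derivative \<Lambda> * ((\<Lambda> * t) ^ n / fact n * c)) (at t)" for n c
        using DERIV_cmult_right[OF has_real_derivative_poisson_term, of \<Lambda> n c t] by (simp only: mult.assoc)
      then have "((\<lambda>t. \<Sum>n<N. (\<Lambda> * t) ^ Suc n / fact (Suc n) * pmf (kernel_power K (Suc n) x) y)
          has_real_derivative \<Lambda> * S' t) (at t)"
        unfolding S'_def sum_distrib_left by (intro DERIV_sum) auto
      from DERIV_add[OF DERIV_const[of "pmf (kernel_power K 0 x) y"] this]
      show ?thesis
        unfolding S_def sum.lessThan_Suc_shift by simp
    qed
    have "g 0 \<le> g t"
    proof (rule dini_monotone)
      have "continuous_on {0..t} (\<lambda>t. S (Suc N) t y)"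
        using S_deriv by (meson DERIV_isCont continuous_at_imp_continuous_on)
      then show "continuous_on {0..t} g"
        unfolding g_def by (intro continuous_intros continuous_on_subset[OF cont]) auto
      fix \<tau> e :: real assume \<tau>: "0 \<le> \<tau>" "\<tau> < t" and e: "0 < e"
      define \<rho> where "\<rho> = exp (- (\<Lambda> * \<tau>)) * S' \<tau>"
      \<comment> \<open>A smooth minorant of \<open>g (\<tau> + s)\<close> up to an error \<open>o(s)\<close>, with derivative \<open>0\<close> at \<open>s = 0\<close>.\<close>
      define G where "G s = exp (\<Lambda> * (\<tau> + s)) * (p \<tau> y + s * (\<Lambda> * (\<rho> - p \<tau> y))) - S (Suc N) (\<tau> + s) y" for s
      define M where "M = exp (\<Lambda> * (\<tau> + 1))"
      have S_d0: "((\<lambda>s. S (Suc N) (\<tau> + s) y) has_real_derivative \<Lambda> * S' \<tau>) (at 0)"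
        using DERIV_shift[where f="\<lambda>t. S (Suc N) t y" and x=0 and z=\<tau>] S_deriv[of \<tau>]
        by (simp add: add.commute)
      have "exp (\<Lambda> * \<tau>) * \<rho> = S' \<tau>"
        by (simp add: \<rho>_def mult.assoc[symmetric] mult_exp_exp)
      moreover have "((\<lambda>s. exp (\<Lambda> * (\<tau> + s)) * (p \<tau> y + s * (\<Lambda> * (\<rho> - p \<tau> y))))
          has_real_derivative \<Lambda> * (exp (\<Lambda> * \<tau>) * \<rho>)) (at 0)"
        by (auto intro!: derivative_eq_intros simp: algebra_simps)
      ultimately have "(G has_real_derivative 0) (at 0)"
        unfolding G_def by (intro DERIV_cong[OF DERIV_diff[OF _ S_d0]]) auto
      then have "((\<lambda>s. (G s - G 0) / s) \<longlongrightarrow> 0) (at_right 0)"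
        by (auto simp: DERIV_def intro: tendsto_within_subset)
      then have "\<forall>\<^sub>F s in at_right 0. \<bar>(G s - G 0) / s\<bar> < e / 2"
        using tendstoD[of _ 0 _ "e / 2"] e by (force simp: dist_real_def)
      moreover have "\<forall>\<^sub>F s in at_right 0. s < (1::real)"
        using eventually_at_right_real[of 0 "1::real"] by (auto elim: eventually_mono)
      moreover have "0 < e / (2 * M)" using e by (simp add: M_def)
      note deriv[OF this, of y]
      ultimately show "\<forall>\<^sub>F s in at_right 0. g \<tau> - e * s \<le> g (\<tau> + s)"
      proof eventually_elim
        case (elim s)
        have "G 0 - e / 2 * s \<le> G s"
        proof -
          have "- (e / 2) * s \<le> (G s - G 0) / s * s"
            using elim(1,3) unfolding abs_less_iff by (intro mult_right_mono) linarith+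
          then show ?thesis using elim by simp
        qed
        moreover have "G 0 = g \<tau>" by (simp add: G_def g_def)
        moreover have "G s - e / 2 * s \<le> g (\<tau> + s)"
        proof -
          have "p (\<tau> + s) y \<ge> p \<tau> y + s * (\<Lambda> * (r \<tau> y - p \<tau> y)) - e / (2 * M) * s"
            using elim(3) \<tau> by (auto simp: abs_le_iff algebra_simps)
          moreover have "s * (\<Lambda> * (\<rho> - p \<tau> y)) \<le> s * (\<Lambda> * (r \<tau> y - p \<tau> y))"
            using r_ge[OF \<tau>(1)] elim(3) \<Lambda> by (intro mult_left_mono) (auto simp: \<rho>_def)
          ultimately have "exp (\<Lambda> * (\<tau> + s)) * (p \<tau> y + s * (\<Lambda> * (\<rho> - p \<tau> y)) - e / (2 * M) * s)
              \<le> exp (\<Lambda> * (\<tau> + s)) * p (\<tau> + s) y"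
            by (intro mult_left_mono) auto
          moreover have "exp (\<Lambda> * (\<tau> + s)) * (e / (2 * M) * s) \<le> M * (e / (2 * M) * s)"
            using elim \<Lambda> e by (intro mult_right_mono) (auto simp: M_def intro!: mult_nonneg_nonneg)
          moreover have "M * (e / (2 * M) * s) = e / 2 * s" by (simp add: M_def)
          ultimately show ?thesis by (simp add: G_def g_def algebra_simps)
        qed
        ultimately show ?case by (simp add: field_simps)
      qed
    qed (use Suc in auto)
    moreover have "g 0 = 0"
      by (simp add: g_def S_def p_def P0 sum.lessThan_Suc_shift del: sum.lessThan_Suc)
    ultimately have "S (Suc N) t y \<le> exp (\<Lambda> * t) * p t y"
      by (simp add: g_def)
    then have "exp (- (\<Lambda> * t)) * S (Suc N) t y \<le> exp (- (\<Lambda> * t)) * (exp (\<Lambda> * t) * p t y)"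
      by (intro mult_left_mono) auto
    then show ?case by (simp add: mult.assoc[symmetric] mult_exp_exp)
  qed
  have pos: "0 < \<Lambda> * t" using \<Lambda> t by simp
  have "bind_pmf (poisson_pmf (\<Lambda> * t)) (\<lambda>n. kernel_power K n x) = P t x"
  proof (rule pmf_eqI_le)
    fix y
    have "ennreal (pmf (bind_pmf (poisson_pmf (\<Lambda> * t)) (\<lambda>n. kernel_power K n x)) y)
       = (\<Sum>n. ennreal (exp (- (\<Lambda> * t)) * ((\<Lambda> * t) ^ n / fact n * pmf (kernel_power K n x) y)))"
      unfolding pmf_bind_count_space nn_integral_count_space_nat using pos
      by (simp add: ac_simps)
    also have "\<dots> \<le> ennreal (p t y)"
    proof (rule suminf_le_const)
      fix N
      have "(\<Sum>n<N. ennreal (exp (- (\<Lambda> * t)) * ((\<Lambda> * t) ^ n / fact n * pmf (kernel_power K n x) y)))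
          = ennreal (exp (- (\<Lambda> * t)) * S N t y)"
        unfolding S_def sum_distrib_left using pos by (intro sum_ennreal) auto
      also have "\<dots> \<le> ennreal (p t y)"
        using lower[of t N y] t by (intro ennreal_leI) auto
      finally show "(\<Sum>n<N. ennreal (exp (- (\<Lambda> * t)) * ((\<Lambda> * t) ^ n / fact n * pmf (kernel_power K n x) y)))
        \<le> ennreal (p t y)" .
    qed auto
    finally show "pmf (bind_pmf (poisson_pmf (\<Lambda> * t)) (\<lambda>n. kernel_power K n x)) y \<le> pmf (P t x) y"
      by (simp add: p_def)
  qed
  then show ?thesis ..
qed

text \<open>
  The time integral of the \<open>k\<close>-th Poisson weight up to \<open>T\<close> is \<open>1 / \<Lambda>\<close> times the probability of more
  than \<open>k\<close> jumps before \<open>T\<close>, since the weights satisfy a telescoping differential equation.  Hence an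
  occupation time integral is an expected sum over the jumps before \<open>T\<close>.
\<close>

lemma poisson_time_integral:
  fixes a :: "nat \<Rightarrow> ennreal"
  assumes \<Lambda>: "0 < \<Lambda>" and T: "0 < T"
  shows "(\<integral>\<^sup>+s\<in>{0..T}. (\<integral>\<^sup>+n. a n \<partial>poisson_pmf (\<Lambda> * s)) \<partial>lborel)
    = ennreal (1 / \<Lambda>) * (\<integral>\<^sup>+n. (\<Sum>k<n. a k) \<partial>poisson_pmf (\<Lambda> * T))"
proof -
  define w where "w k s = (\<Lambda> * s) ^ k / fact k * exp (- (\<Lambda> * s))" for k s
  have w0: "0 \<le> s \<Longrightarrow> 0 \<le> w k s" for k s using \<Lambda> by (simp add: w_def)
  have [measurable]: "w k \<in> borel_measurable borel" for k unfolding w_def by measurable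
  have pos: "0 < \<Lambda> * T" using \<Lambda> T by simp
  \<comment> \<open>The antiderivative \<open>F\<close> below is minus the distribution function at \<open>k\<close>, divided by \<open>\<Lambda>\<close>.\<close>
  have tail: "(\<integral>\<^sup>+s. ennreal (w k s) * indicator {0..T} s \<partial>lborel)
      = ennreal (1 / \<Lambda>) * emeasure (poisson_pmf (\<Lambda> * T)) {k<..}" for k
  proof -
    define F where "F s = - (\<Sum>j\<le>k. w j s) / \<Lambda>" for s
    have "((\<lambda>s. \<Sum>j\<le>k. w j s) has_real_derivative - \<Lambda> * w k s) (at s)" for s k
    proof (induction k)
      case 0
      show ?case unfolding w_def by (auto intro!: derivative_eq_intros)
    next
      case (Suc k)
      have "((\<lambda>t. (\<Lambda> * t) ^ Suc k / fact (Suc k)) has_real_derivative \<Lambda> * ((\<Lambda> * s) ^ k / fact k)) (at s)"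
        by (rule has_real_derivative_poisson_term)
      moreover have "((\<lambda>t. exp (- (\<Lambda> * t))) has_real_derivative - \<Lambda> * exp (- (\<Lambda> * s))) (at s)"
        by (auto intro!: derivative_eq_intros)
      ultimately have "(w (Suc k) has_real_derivative \<Lambda> * w k s - \<Lambda> * w (Suc k) s) (at s)"
        unfolding w_def by (rule DERIV_cong[OF DERIV_mult]) (simp only: algebra_simps)
      from DERIV_add[OF Suc this] show ?case by simp
    qed
    then have F': "(F has_real_derivative w k s) (at s)" for s
      unfolding F_def using \<Lambda> by (intro DERIV_cong[OF DERIV_cdivide[OF DERIV_minus]]) auto
    have "(\<integral>\<^sup>+s. ennreal (w k s) * indicator {0..T} s \<partial>lborel) = ennreal (F T - F 0)"
      using T by (intro nn_integral_FTC_Icc) (auto intro!: F' w0)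
    also have "F T - F 0 = 1 / \<Lambda> * (1 - (\<Sum>j\<le>k. w j T))"
    proof -
      have "w j 0 = (if j = 0 then 1 else 0)" for j by (simp add: w_def)
      then have "(\<Sum>j\<le>k. w j 0) = 1" by simp
      then show ?thesis using \<Lambda> by (simp add: F_def field_simps)
    qed
    also have "1 - (\<Sum>j\<le>k. w j T) = measure (poisson_pmf (\<Lambda> * T)) {k<..}"
    proof -
      have "(\<Sum>j\<le>k. w j T) = measure (poisson_pmf (\<Lambda> * T)) {..k}"
        using pos by (simp add: measure_measure_pmf_finite w_def)
      moreover have "{k<..} = UNIV - {..k}" by auto
      ultimately show ?thesis
        using measure_pmf.prob_compl[of "{..k}" "poisson_pmf (\<Lambda> * T)"] by simp
    qed
    finally show ?thesis
      using \<Lambda> by (simp add: measure_pmf.emeasure_eq_measure ennreal_mult[symmetric])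
  qed
  have "(\<integral>\<^sup>+s\<in>{0..T}. (\<integral>\<^sup>+n. a n \<partial>poisson_pmf (\<Lambda> * s)) \<partial>lborel)
     = (\<integral>\<^sup>+s. (\<Sum>n. a n * (ennreal (w n s) * indicator {0..T} s)) \<partial>lborel)"
  proof (intro nn_integral_cong_AE, use AE_lborel_singleton[of "0::real"] in eventually_elim)
    case (elim s)
    show ?case
    proof (cases "0 < s")
      case True
      then have "(\<integral>\<^sup>+n. a n \<partial>poisson_pmf (\<Lambda> * s)) = (\<Sum>n. a n * ennreal (w n s))"
        using \<Lambda> by (simp add: nn_integral_measure_pmf nn_integral_count_space_nat w_def mult.commute)
      then show ?thesis
        by (simp add: ennreal_suminf_multc[symmetric] mult.assoc)
    qed (use elim in auto)
  qed
  also have "\<dots> = (\<Sum>n. a n * (ennreal (1 / \<Lambda>) * emeasure (poisson_pmf (\<Lambda> * T)) {n<..}))"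
    by (subst nn_integral_suminf) (simp_all add: nn_integral_cmult tail)
  also have "\<dots> = ennreal (1 / \<Lambda>) * (\<Sum>n. a n * emeasure (poisson_pmf (\<Lambda> * T)) {n<..})"
    by (subst ennreal_suminf_cmult[symmetric]) (simp add: ac_simps)
  also have "(\<Sum>n. a n * emeasure (poisson_pmf (\<Lambda> * T)) {n<..})
     = (\<integral>\<^sup>+m. (\<Sum>n. a n * indicator {n<..} m) \<partial>poisson_pmf (\<Lambda> * T))"
    by (subst nn_integral_suminf) (simp_all add: nn_integral_cmult)
  also have "\<dots> = (\<integral>\<^sup>+m. (\<Sum>k<m. a k) \<partial>poisson_pmf (\<Lambda> * T))"
  proof (intro nn_integral_cong)
    fix m
    have "(\<Sum>n. a n * indicator {n<..} m) = (\<Sum>n<m. a n * indicator {n<..} m)"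
      by (rule suminf_finite) auto
    then show "(\<Sum>n. a n * indicator {n<..} m) = (\<Sum>k<m. a k)" by simp
  qed
  finally show ?thesis .
qed

text \<open>
  The occupation time of the constant \<open>1\<close> up to time \<open>\<mu>\<close>, for jumps of rate \<open>1\<close>.
\<close>

lemma poisson_mean:
  assumes "0 < \<mu>"
  shows "(\<integral>\<^sup>+n. of_nat n \<partial>poisson_pmf \<mu>) = ennreal \<mu>"
  using poisson_time_integral[of 1 \<mu> "\<lambda>_. 1"] assms by (simp add: nn_integral_const)

section \<open>Uniformization of jump rates\<close>

lemma countable_measure_eq_density:
  fixes M :: "'a::countable measure"
  assumes "sets M = UNIV"
  shows "M = density (count_space UNIV) (\<lambda>y. emeasure M {y})"
proof (rule measure_eqI_countable[of _ UNIV])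
  show "emeasure M {a} = emeasure (density (count_space UNIV) (\<lambda>y. emeasure M {y})) {a}" for a
    by (subst emeasure_density) (simp_all add: nn_integral_count_space_indicator)
qed (use assms in auto)

text \<open>
  Uniformization: to the jumps of rate \<open>N x\<close> one adds a fictitious jump from \<open>x\<close> to \<open>x\<close> of rate
  \<open>\<Lambda> - N x UNIV\<close>.  The total rate becomes \<open>\<Lambda>\<close> at every state, and the generator is unchanged.
\<close>

lemma uniformization:
  fixes N :: "'a::countable \<Rightarrow> 'a measure"
  assumes sets: "\<And>x. sets (N x) = UNIV" and \<Lambda>: "0 < \<Lambda>"
    and bound: "\<And>x. emeasure (N x) UNIV \<le> ennreal \<Lambda>"
  shows "\<exists>K :: 'a \<Rightarrow> 'a pmf. \<forall>x f. integrable (N x) f \<longrightarrow>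
    integrable (K x) f \<and> (\<integral>y. (f y - f x) \<partial>N x) = \<Lambda> * ((\<integral>y. f y \<partial>K x) - f x :: real)"
proof -
  have fin: "finite_measure (N x)" for x
    using bound[of x] sets_eq_imp_space_eq[of "N x" "count_space UNIV"] sets[of x]
    by (intro finite_measureI) (auto simp: top_unique)
  define m where "m x y = measure (N x) {y}" for x y
  define M where "M x = measure (N x) UNIV" for x
  have M\<Lambda>: "M x \<le> \<Lambda>" for x
    using bound[of x] \<Lambda> by (simp add: M_def finite_measure.emeasure_eq_measure[OF fin])
  have dens: "N x = density (count_space UNIV) (\<lambda>y. ennreal (m x y))" for x
    using countable_measure_eq_density[OF sets, of x]
    by (simp add: m_def finite_measure.emeasure_eq_measure[OF fin])
  have sum_m: "(\<integral>\<^sup>+y. ennreal (m x y) \<partial>count_space UNIV) = ennreal (M x)" for x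
  proof -
    have "ennreal (M x) = emeasure (density (count_space UNIV) (\<lambda>y. ennreal (m x y))) UNIV"
      unfolding dens[symmetric] by (simp add: M_def finite_measure.emeasure_eq_measure[OF fin])
    then show ?thesis by (subst (asm) emeasure_density) auto
  qed
  define k where "k x y = (m x y + (\<Lambda> - M x) * indicator {x} y) / \<Lambda>" for x y
  have m0: "0 \<le> m x y" for x y by (simp add: m_def)
  have k0: "0 \<le> k x y" for x y
    using \<Lambda> M\<Lambda>[of x] by (auto simp: k_def m0 intro!: divide_nonneg_nonneg add_nonneg_nonneg mult_nonneg_nonneg)
  define K where "K x = embed_pmf (k x)" for x
  have "(\<integral>\<^sup>+y. ennreal (k x y) \<partial>count_space UNIV) = 1" for x
  proof -
    have "(\<integral>\<^sup>+y. ennreal (k x y) \<partial>count_space UNIV)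
      = (\<integral>\<^sup>+y. (ennreal (m x y) + ennreal (\<Lambda> - M x) * indicator {x} y) * ennreal (1 / \<Lambda>) \<partial>count_space UNIV)"
      using \<Lambda> M\<Lambda>[of x] m0 by (intro nn_integral_cong)
        (auto simp: k_def ennreal_mult[symmetric] ennreal_plus[symmetric] simp del: ennreal_plus split: split_indicator)
    also have "\<dots> = (ennreal (M x) + ennreal (\<Lambda> - M x)) * ennreal (1 / \<Lambda>)"
      by (simp add: nn_integral_multc nn_integral_add nn_integral_cmult sum_m)
    also have "\<dots> = 1"
      using \<Lambda> M\<Lambda>[of x] by (simp add: M_def ennreal_mult[symmetric] ennreal_plus[symmetric] del: ennreal_plus)
    finally show ?thesis .
  qed
  then have pmfK: "pmf (K x) y = k x y" for x y
    unfolding K_def by (intro pmf_embed_pmf k0)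
  have *: "integrable (K x) f \<and> (\<integral>y. (f y - f x) \<partial>N x) = \<Lambda> * ((\<integral>y. f y \<partial>K x) - f x)"
    if f: "integrable (N x) f" for x and f :: "'a \<Rightarrow> real"
  proof -
    interpret finite_measure "N x" by (rule fin)
    have spN: "space (N x) = UNIV" using sets_eq_imp_space_eq[of "N x" "count_space UNIV"] sets[of x] by simp
    have i1: "integrable (count_space UNIV) (\<lambda>y. m x y * f y)"
      using f unfolding dens[of x] by (subst (asm) integrable_density) (auto simp: m0)
    have e1: "(\<integral>y. f y \<partial>N x) = (\<integral>y. m x y * f y \<partial>count_space UNIV)"
      by (subst dens, subst integral_density) (auto simp: m0)
    have hb: "has_bochner_integral (count_space UNIV) (\<lambda>y. indicator {x} y * f x) (f x)"
      using has_bochner_integral_mult_left[OF has_bochner_integral_real_indicator[of "{x}" "count_space UNIV"], of "f x"]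
      by simp
    have kf: "k x y * f y = (1 / \<Lambda>) * (m x y * f y + (\<Lambda> - M x) * (indicator {x} y * f x))" for y
      by (auto simp: k_def field_simps split: split_indicator)
    have hbk: "has_bochner_integral (count_space UNIV) (\<lambda>y. k x y * f y)
        ((1 / \<Lambda>) * ((\<integral>y. f y \<partial>N x) + (\<Lambda> - M x) * f x))"
      unfolding kf e1 using i1 hb
      by (intro has_bochner_integral_mult_right has_bochner_integral_add has_bochner_integral_integrable)
    have int: "integrable (K x) f"
      using hbk unfolding measure_pmf_eq_density
      by (subst integrable_density) (auto simp: pmfK k0 has_bochner_integral_iff)
    have "(\<integral>y. f y \<partial>K x) = (\<integral>y. k x y * f y \<partial>count_space UNIV)"
      unfolding measure_pmf_eq_density by (subst integral_density) (auto simp: pmfK k0)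
    also have "\<dots> = (1 / \<Lambda>) * ((\<integral>y. f y \<partial>N x) + (\<Lambda> - M x) * f x)"
      using hbk by (simp add: has_bochner_integral_iff)
    finally have "\<Lambda> * ((\<integral>y. f y \<partial>K x) - f x) = (\<integral>y. f y \<partial>N x) - M x * f x"
      using \<Lambda> by (simp add: field_simps)
    also have "\<dots> = (\<integral>y. (f y - f x) \<partial>N x)"
      using f by (simp add: M_def spN)
    finally show ?thesis using int by simp
  qed
  then show ?thesis by blast
qed

lemma kernel_power_invariant:
  "bind_pmf \<nu> K = \<nu> \<Longrightarrow> bind_pmf \<nu> (kernel_power K n) = \<nu>"
proof (induction n)
  case 0
  have "kernel_power K 0 = return_pmf" by auto
  then show ?case by (simp add: bind_return_pmf')
next
  case (Suc n)
  have "kernel_power K (Suc n) = (\<lambda>x. bind_pmf (kernel_power K n x) K)" by auto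
  then show ?case using Suc by (simp add: bind_assoc_pmf[symmetric])
qed

text \<open>
  Starting from the invariant law, the chain starts at \<open>x\<close> with probability \<open>pmf \<nu> x\<close> and has law \<open>\<nu>\<close>
  after \<open>n\<close> steps.  This gives a moment bound that does not depend on \<open>n\<close>.
\<close>

lemma kernel_power_moment:
  fixes K :: "'a \<Rightarrow> 'a pmf"
  assumes "bind_pmf \<nu> K = \<nu>"
  shows "ennreal (pmf \<nu> x) * (\<integral>\<^sup>+y. f y \<partial>kernel_power K n x) \<le> (\<integral>\<^sup>+y. f y \<partial>\<nu>)"
proof -
  have "ennreal (pmf \<nu> x) * (\<integral>\<^sup>+y. f y \<partial>kernel_power K n x)
    = (\<integral>\<^sup>+z. (\<integral>\<^sup>+y. f y \<partial>kernel_power K n x) * indicator {x} z \<partial>\<nu>)"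
    by (subst nn_integral_cmult_indicator) (simp_all add: emeasure_pmf_single mult.commute)
  also have "\<dots> \<le> (\<integral>\<^sup>+z. (\<integral>\<^sup>+y. f y \<partial>kernel_power K n z) \<partial>\<nu>)"
    by (intro nn_integral_mono) (auto split: split_indicator)
  also have "\<dots> = (\<integral>\<^sup>+y. f y \<partial>\<nu>)"
    by (subst (2) kernel_power_invariant[OF assms, of n, symmetric]) simp
  finally show ?thesis .
qed

text \<open>
  Everything that is used about the process generated by one control: the uniformized chain \<open>K\<close>, the
  Poisson formula for any semigroup with the given generator, and an invariant law of full support.
  By the Poisson formula a law that is invariant for \<open>K\<close> is invariant for the semigroup, and
  irreducibility makes it charge every point.
\<close>

lemma uniformized_chain:
  fixes N :: "'s::countable discrete \<Rightarrow> 's discrete measure"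
  assumes sets: "\<And>x. sets (N x) = UNIV" and \<Lambda>: "0 < \<Lambda>"
    and bound: "\<And>x. emeasure (N x) UNIV \<le> ennreal \<Lambda>"
    and L: "\<And>f x. L f x = (\<integral>y. (f y - f x) \<partial>N x)"
    and irr: "generates_irreducible L"
    and \<Psi>0: "\<And>x. 0 \<le> \<Psi> x" and \<Psi>: "\<And>x. integrable (N x) \<Psi>"
    and C: "finite C" and drift: "\<And>x. L \<Psi> x \<le> - 1 + b * indicator C x"
  obtains K :: "'s discrete \<Rightarrow> 's discrete pmf" and \<nu> where
    "\<And>x (f :: _ \<Rightarrow> real). integrable (N x) f \<Longrightarrow> integrable (K x) f"
    "\<And>x f. integrable (N x) f \<Longrightarrow> L f x = \<Lambda> * ((\<integral>y. f y \<partial>K x) - f x)"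
    "bind_pmf \<nu> K = \<nu>" "invariant_law L \<nu>" "\<And>x. 0 < pmf \<nu> x"
    "\<And>P t x. semigroup_generated_by L P \<Longrightarrow> 0 < t \<Longrightarrow>
        P t x = bind_pmf (poisson_pmf (\<Lambda> * t)) (\<lambda>n. kernel_power K n x)"
proof -
  obtain K :: "'s discrete \<Rightarrow> 's discrete pmf" where K: "\<forall>x f. integrable (N x) f \<longrightarrow>
      integrable (K x) f \<and> (\<integral>y. (f y - f x) \<partial>N x) = \<Lambda> * ((\<integral>y. f y \<partial>K x) - f x :: real)"
    using uniformization[of N, OF sets \<Lambda> bound] by (elim exE) (rule that)
  have Kint: "integrable (N x) f \<Longrightarrow> integrable (K x) f" for x and f :: "_ \<Rightarrow> real" using K by simp
  have LK: "integrable (N x) f \<Longrightarrow> L f x = \<Lambda> * ((\<integral>y. f y \<partial>K x) - f x)" for f x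
    using K L by simp
  have Lind: "L (indicator {y}) x = \<Lambda> * (pmf (K x) y - indicator {y} x)" for x y
  proof -
    have "emeasure (N x) UNIV < \<infinity>" using bound[of x] by (auto simp: less_top[symmetric] top_unique)
    then have "integrable (N x) (indicator {y} :: _ \<Rightarrow> real)"
      using emeasure_mono[of "{y}" UNIV "N x"] sets[of x]
      by (auto intro!: integrable_real_indicator)
    then show ?thesis by (simp add: LK measure_pmf_single)
  qed
  have poisson: "P t x = bind_pmf (poisson_pmf (\<Lambda> * t)) (\<lambda>n. kernel_power K n x)"
    if "semigroup_generated_by L P" "0 < t" for P t x
    using semigroup_eq_poisson[OF that(1) \<Lambda> Lind that(2)] .
  have dr: "(\<integral>\<^sup>+y. ennreal (\<Psi> y) \<partial>K x) + ennreal (1 / \<Lambda>)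
      \<le> ennreal (\<Psi> x) + ennreal (\<bar>b\<bar> / \<Lambda>) * indicator C x" for x
  proof -
    have "\<Lambda> * (\<integral>y. \<Psi> y \<partial>K x) + 1 \<le> \<Lambda> * \<Psi> x + \<bar>b\<bar> * indicator C x"
      using drift[of x] LK[OF \<Psi>, of x] by (auto simp: algebra_simps split: split_indicator)
    then have "(\<Lambda> * (\<integral>y. \<Psi> y \<partial>K x) + 1) / \<Lambda> \<le> (\<Lambda> * \<Psi> x + \<bar>b\<bar> * indicator C x) / \<Lambda>"
      using \<Lambda> by (intro divide_right_mono) auto
    then have "(\<integral>y. \<Psi> y \<partial>K x) + 1 / \<Lambda> \<le> \<Psi> x + \<bar>b\<bar> / \<Lambda> * indicator C x"
      using \<Lambda> by (simp add: add_divide_distrib)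
    moreover have "(\<integral>\<^sup>+y. ennreal (\<Psi> y) \<partial>K x) = ennreal (\<integral>y. \<Psi> y \<partial>K x)"
      using Kint[OF \<Psi>] \<Psi>0 by (intro nn_integral_eq_integral) auto
    moreover have "0 \<le> (\<integral>y. \<Psi> y \<partial>K x)" using \<Psi>0 by simp
    ultimately show ?thesis
      using \<Psi>0[of x] \<Lambda> by (auto simp: ennreal_plus[symmetric] intro!: ennreal_leI simp del: ennreal_plus split: split_indicator_asm split_indicator)
  qed
  obtain \<nu> where \<nu>: "bind_pmf \<nu> K = \<nu>"
    using foster_invariant[OF \<Psi>0 _ C _ dr] \<Lambda> by auto
  have inv: "bind_pmf \<nu> (P t) = \<nu>" if "semigroup_generated_by L P" "0 \<le> t" for P t
  proof (cases "t = 0")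
    case True
    with that(1) have "P t = return_pmf" by (auto simp: semigroup_generated_by_def)
    then show ?thesis by (simp add: bind_return_pmf')
  next
    case False
    then have "P t = (\<lambda>x. bind_pmf (poisson_pmf (\<Lambda> * t)) (\<lambda>n. kernel_power K n x))"
      using poisson[OF that(1)] that(2) by auto
    then show ?thesis
      by (simp add: bind_commute_pmf[of \<nu>] kernel_power_invariant[OF \<nu>])
  qed
  obtain P where P: "semigroup_generated_by L P" "\<And>x y. \<exists>t>0. pmf (P t x) y > 0"
    using irr by (auto simp: generates_irreducible_def)
  have pos: "0 < pmf \<nu> y" for y
  proof -
    obtain x where x: "x \<in> set_pmf \<nu>" using set_pmf_not_empty[of \<nu>] by auto
    obtain t where t: "t > 0" "pmf (P t x) y > 0" using P by blast
    then have "y \<in> set_pmf (P t x)" by (simp add: set_pmf_iff)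
    with x have "y \<in> set_pmf (bind_pmf \<nu> (P t))" by auto
    then show ?thesis using inv[OF P(1)] t by (simp add: pmf_positive_iff)
  qed
  have "invariant_law L \<nu>"
    using P(1) inv by (auto simp: invariant_law_def)
  then show thesis
    using that[of K \<nu>] Kint LK \<nu> poisson pos by blast
qed

section \<open>Accumulated cost along the chain\<close>

text \<open>
  Here \<open>\<Psi>\<close> is a potential: \<open>\<Lambda>\<close> times the expected potential plus the accumulated cost grows by at
  least \<open>g\<close> in each step.  Working in \<^typ>\<open>ennreal\<close> with both sides as sums of nonnegative terms
  removes all integrability questions.
\<close>

lemma kernel_power_cost_ge:
  fixes K :: "'a \<Rightarrow> 'a pmf" and c \<Psi> :: "'a \<Rightarrow> ennreal"
  assumes "\<And>x. g + \<Lambda> * \<Psi> x \<le> \<Lambda> * (\<integral>\<^sup>+y. \<Psi> y \<partial>K x) + c x"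
  shows "of_nat n * g + \<Lambda> * \<Psi> x
    \<le> \<Lambda> * (\<integral>\<^sup>+y. \<Psi> y \<partial>kernel_power K n x) + (\<Sum>k<n. \<integral>\<^sup>+y. c y \<partial>kernel_power K k x)"
proof (induction n)
  case (Suc n)
  have "g + \<Lambda> * (\<integral>\<^sup>+y. \<Psi> y \<partial>kernel_power K n x) = (\<integral>\<^sup>+y. g + \<Lambda> * \<Psi> y \<partial>kernel_power K n x)"
    by (simp add: nn_integral_add nn_integral_cmult)
  also have "\<dots> \<le> (\<integral>\<^sup>+z. \<Lambda> * (\<integral>\<^sup>+y. \<Psi> y \<partial>K z) + c z \<partial>kernel_power K n x)"
    by (intro nn_integral_mono assms)
  also have "\<dots> = \<Lambda> * (\<integral>\<^sup>+y. \<Psi> y \<partial>kernel_power K (Suc n) x) + (\<integral>\<^sup>+y. c y \<partial>kernel_power K n x)"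
    by (simp add: nn_integral_add nn_integral_cmult)
  finally have step: "g + \<Lambda> * (\<integral>\<^sup>+y. \<Psi> y \<partial>kernel_power K n x) \<le> \<dots>" .
  have "of_nat (Suc n) * g + \<Lambda> * \<Psi> x = g + (of_nat n * g + \<Lambda> * \<Psi> x)"
    by (simp add: algebra_simps)
  also have "\<dots> \<le> g + (\<Lambda> * (\<integral>\<^sup>+y. \<Psi> y \<partial>kernel_power K n x) + (\<Sum>k<n. \<integral>\<^sup>+y. c y \<partial>kernel_power K k x))"
    by (intro add_left_mono Suc)
  also have "\<dots> = g + \<Lambda> * (\<integral>\<^sup>+y. \<Psi> y \<partial>kernel_power K n x) + (\<Sum>k<n. \<integral>\<^sup>+y. c y \<partial>kernel_power K k x)"
    by (simp only: add.assoc)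
  also have "\<dots> \<le> \<Lambda> * (\<integral>\<^sup>+y. \<Psi> y \<partial>kernel_power K (Suc n) x) + (\<integral>\<^sup>+y. c y \<partial>kernel_power K n x)
      + (\<Sum>k<n. \<integral>\<^sup>+y. c y \<partial>kernel_power K k x)"
    by (intro add_right_mono step)
  finally show ?case by (simp only: sum.lessThan_Suc ac_simps)
qed simp

lemma kernel_power_cost_le:
  fixes K :: "'a \<Rightarrow> 'a pmf" and c \<Psi> :: "'a \<Rightarrow> ennreal"
  assumes "\<And>x. \<Lambda> * (\<integral>\<^sup>+y. \<Psi> y \<partial>K x) + c x \<le> g + \<Lambda> * \<Psi> x"
  shows "\<Lambda> * (\<integral>\<^sup>+y. \<Psi> y \<partial>kernel_power K n x) + (\<Sum>k<n. \<integral>\<^sup>+y. c y \<partial>kernel_power K k x)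
    \<le> of_nat n * g + \<Lambda> * \<Psi> x"
proof (induction n)
  case (Suc n)
  have "\<Lambda> * (\<integral>\<^sup>+y. \<Psi> y \<partial>kernel_power K (Suc n) x) + (\<integral>\<^sup>+y. c y \<partial>kernel_power K n x)
    = (\<integral>\<^sup>+z. \<Lambda> * (\<integral>\<^sup>+y. \<Psi> y \<partial>K z) + c z \<partial>kernel_power K n x)"
    by (simp add: nn_integral_add nn_integral_cmult)
  also have "\<dots> \<le> (\<integral>\<^sup>+y. g + \<Lambda> * \<Psi> y \<partial>kernel_power K n x)"
    by (intro nn_integral_mono assms)
  also have "\<dots> = g + \<Lambda> * (\<integral>\<^sup>+y. \<Psi> y \<partial>kernel_power K n x)"
    by (simp add: nn_integral_add nn_integral_cmult)
  finally have step: "\<Lambda> * (\<integral>\<^sup>+y. \<Psi> y \<partial>kernel_power K (Suc n) x) + (\<integral>\<^sup>+y. c y \<partial>kernel_power K n x) \<le> \<dots>" .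
  have "\<Lambda> * (\<integral>\<^sup>+y. \<Psi> y \<partial>kernel_power K (Suc n) x) + (\<Sum>k<Suc n. \<integral>\<^sup>+y. c y \<partial>kernel_power K k x)
    = \<Lambda> * (\<integral>\<^sup>+y. \<Psi> y \<partial>kernel_power K (Suc n) x) + (\<integral>\<^sup>+y. c y \<partial>kernel_power K n x)
      + (\<Sum>k<n. \<integral>\<^sup>+y. c y \<partial>kernel_power K k x)"
    by (simp only: sum.lessThan_Suc ac_simps)
  also have "\<dots> \<le> g + \<Lambda> * (\<integral>\<^sup>+y. \<Psi> y \<partial>kernel_power K n x) + (\<Sum>k<n. \<integral>\<^sup>+y. c y \<partial>kernel_power K k x)"
    by (intro add_right_mono step)
  also have "\<dots> \<le> g + (of_nat n * g + \<Lambda> * \<Psi> x)"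
    unfolding add.assoc by (intro add_left_mono Suc)
  finally show ?case by (simp add: algebra_simps)
qed simp

lemma occupation_cost:
  fixes P :: "real \<Rightarrow> 'a \<Rightarrow> 'a pmf"
  assumes \<Lambda>: "0 < \<Lambda>" and T: "0 < T"
    and P: "\<And>t. 0 < t \<Longrightarrow> P t x = bind_pmf (poisson_pmf (\<Lambda> * t)) (\<lambda>n. kernel_power K n x)"
  shows "(\<integral>\<^sup>+s\<in>{0..T}. (\<integral>\<^sup>+y. f y \<partial>P s x) \<partial>lborel)
    = ennreal (1 / \<Lambda>) * (\<integral>\<^sup>+n. (\<Sum>k<n. \<integral>\<^sup>+y. f y \<partial>kernel_power K k x) \<partial>poisson_pmf (\<Lambda> * T))"
proof -
  have "(\<integral>\<^sup>+s\<in>{0..T}. (\<integral>\<^sup>+y. f y \<partial>P s x) \<partial>lborel)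
    = (\<integral>\<^sup>+s\<in>{0..T}. (\<integral>\<^sup>+n. (\<integral>\<^sup>+y. f y \<partial>kernel_power K n x) \<partial>poisson_pmf (\<Lambda> * s)) \<partial>lborel)"
    by (intro nn_integral_cong_AE, use AE_lborel_singleton[of "0::real"] in eventually_elim)
       (auto simp: P split: split_indicator)
  also have "\<dots> = ennreal (1 / \<Lambda>) * (\<integral>\<^sup>+n. (\<Sum>k<n. \<integral>\<^sup>+y. f y \<partial>kernel_power K k x) \<partial>poisson_pmf (\<Lambda> * T))"
    by (rule poisson_time_integral[OF \<Lambda> T])
  finally show ?thesis .
qed

text \<open>
  The potential left at time \<open>T\<close> is nonnegative and can be dropped, and the expected number of jumps
  before \<open>T\<close> is \<open>\<Lambda> T\<close>.
\<close>

lemma occupation_cost_le: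
  fixes P :: "real \<Rightarrow> 'a \<Rightarrow> 'a pmf" and K :: "'a \<Rightarrow> 'a pmf" and f :: "'a \<Rightarrow> ennreal"
  assumes \<Lambda>: "0 < \<Lambda>" and T: "0 < T" and g: "0 \<le> g" and \<Psi>: "\<And>x. 0 \<le> \<Psi> x"
    and P: "\<And>t. 0 < t \<Longrightarrow> P t x = bind_pmf (poisson_pmf (\<Lambda> * t)) (\<lambda>n. kernel_power K n x)"
    and eq: "\<And>x. ennreal \<Lambda> * (\<integral>\<^sup>+y. ennreal (\<Psi> y) \<partial>K x) + f x \<le> ennreal g + ennreal \<Lambda> * ennreal (\<Psi> x)"
  shows "(\<integral>\<^sup>+s\<in>{0..T}. (\<integral>\<^sup>+y. f y \<partial>P s x) \<partial>lborel) \<le> ennreal (T * g + \<Psi> x)"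
proof -
  have "(\<integral>\<^sup>+n. (\<Sum>k<n. \<integral>\<^sup>+y. f y \<partial>kernel_power K k x) \<partial>poisson_pmf (\<Lambda> * T))
     \<le> (\<integral>\<^sup>+n. of_nat n * ennreal g + ennreal \<Lambda> * ennreal (\<Psi> x) \<partial>poisson_pmf (\<Lambda> * T))"
    by (intro nn_integral_mono order_trans[OF _ kernel_power_cost_le[OF eq]]) (simp add: add_increasing)
  also have "\<dots> = ennreal (\<Lambda> * T) * ennreal g + ennreal \<Lambda> * ennreal (\<Psi> x)"
    using \<Lambda> T by (simp add: nn_integral_add nn_integral_multc poisson_mean)
  finally have "ennreal (1 / \<Lambda>) * (\<integral>\<^sup>+n. (\<Sum>k<n. \<integral>\<^sup>+y. f y \<partial>kernel_power K k x) \<partial>poisson_pmf (\<Lambda> * T))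
     \<le> ennreal (1 / \<Lambda>) * (ennreal (\<Lambda> * T) * ennreal g + ennreal \<Lambda> * ennreal (\<Psi> x))"
    by (rule mult_left_mono) simp
  also have "\<dots> = ennreal (T * g + \<Psi> x)"
    using \<Lambda> T g \<Psi>[of x]
    by (simp add: ennreal_mult[symmetric] ennreal_plus[symmetric] field_simps del: ennreal_plus)
  moreover have "(\<integral>\<^sup>+s\<in>{0..T}. (\<integral>\<^sup>+y. f y \<partial>P s x) \<partial>lborel)
    = ennreal (1 / \<Lambda>) * (\<integral>\<^sup>+n. (\<Sum>k<n. \<integral>\<^sup>+y. f y \<partial>kernel_power K k x) \<partial>poisson_pmf (\<Lambda> * T))"
    by (rule occupation_cost[OF \<Lambda> T]) (rule P)
  ultimately show ?thesis by simp
qed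

text \<open>
  The potential left at time \<open>T\<close> costs at most \<open>B\<close>, a bound on its expectation at all steps.
\<close>

lemma occupation_cost_ge:
  fixes P :: "real \<Rightarrow> 'a \<Rightarrow> 'a pmf" and K :: "'a \<Rightarrow> 'a pmf" and f :: "'a \<Rightarrow> ennreal"
  assumes \<Lambda>: "0 < \<Lambda>" and T: "0 < T" and g: "0 \<le> g" and B: "0 \<le> B"
    and P: "\<And>t. 0 < t \<Longrightarrow> P t x = bind_pmf (poisson_pmf (\<Lambda> * t)) (\<lambda>n. kernel_power K n x)"
    and eq: "\<And>x. ennreal g + ennreal \<Lambda> * \<Psi> x \<le> ennreal \<Lambda> * (\<integral>\<^sup>+y. \<Psi> y \<partial>K x) + f x"
    and bd: "\<And>n. (\<integral>\<^sup>+y. \<Psi> y \<partial>kernel_power K n x) \<le> ennreal B"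
  shows "ennreal (T * g) \<le> ennreal B + (\<integral>\<^sup>+s\<in>{0..T}. (\<integral>\<^sup>+y. f y \<partial>P s x) \<partial>lborel)"
proof -
  have "ennreal (\<Lambda> * T) * ennreal g = (\<integral>\<^sup>+n. of_nat n * ennreal g \<partial>poisson_pmf (\<Lambda> * T))"
    using \<Lambda> T by (simp add: nn_integral_multc poisson_mean)
  also have "\<dots> \<le> (\<integral>\<^sup>+n. ennreal \<Lambda> * ennreal B + (\<Sum>k<n. \<integral>\<^sup>+y. f y \<partial>kernel_power K k x) \<partial>poisson_pmf (\<Lambda> * T))"
  proof (intro nn_integral_mono)
    fix n
    have "of_nat n * ennreal g \<le> of_nat n * ennreal g + ennreal \<Lambda> * \<Psi> x"
      by simp
    also have "\<dots> \<le> ennreal \<Lambda> * (\<integral>\<^sup>+y. \<Psi> y \<partial>kernel_power K n x) + (\<Sum>k<n. \<integral>\<^sup>+y. f y \<partial>kernel_power K k x)"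
      by (rule kernel_power_cost_ge[OF eq])
    also have "\<dots> \<le> ennreal \<Lambda> * ennreal B + (\<Sum>k<n. \<integral>\<^sup>+y. f y \<partial>kernel_power K k x)"
      by (intro add_right_mono mult_left_mono bd) simp
    finally show "of_nat n * ennreal g \<le> \<dots>" .
  qed
  also have "\<dots> = ennreal \<Lambda> * ennreal B + (\<integral>\<^sup>+n. (\<Sum>k<n. \<integral>\<^sup>+y. f y \<partial>kernel_power K k x) \<partial>poisson_pmf (\<Lambda> * T))"
    by (simp add: nn_integral_add)
  finally have "ennreal (1 / \<Lambda>) * (ennreal (\<Lambda> * T) * ennreal g)
     \<le> ennreal (1 / \<Lambda>) * (ennreal \<Lambda> * ennreal B + (\<integral>\<^sup>+n. (\<Sum>k<n. \<integral>\<^sup>+y. f y \<partial>kernel_power K k x) \<partial>poisson_pmf (\<Lambda> * T)))"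
    by (rule mult_left_mono) simp
  also have "ennreal (1 / \<Lambda>) * (ennreal (\<Lambda> * T) * ennreal g) = ennreal (T * g)"
    using \<Lambda> T g by (simp add: ennreal_mult[symmetric])
  also have "ennreal (1 / \<Lambda>) * (ennreal \<Lambda> * ennreal B + (\<integral>\<^sup>+n. (\<Sum>k<n. \<integral>\<^sup>+y. f y \<partial>kernel_power K k x) \<partial>poisson_pmf (\<Lambda> * T)))
     = ennreal B + ennreal (1 / \<Lambda>) * (\<integral>\<^sup>+n. (\<Sum>k<n. \<integral>\<^sup>+y. f y \<partial>kernel_power K k x) \<partial>poisson_pmf (\<Lambda> * T))"
    using \<Lambda> B by (simp add: distrib_left mult.assoc[symmetric] ennreal_mult[symmetric])
  moreover have "(\<integral>\<^sup>+s\<in>{0..T}. (\<integral>\<^sup>+y. f y \<partial>P s x) \<partial>lborel)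
    = ennreal (1 / \<Lambda>) * (\<integral>\<^sup>+n. (\<Sum>k<n. \<integral>\<^sup>+y. f y \<partial>kernel_power K k x) \<partial>poisson_pmf (\<Lambda> * T))"
    by (rule occupation_cost[OF \<Lambda> T]) (rule P)
  ultimately show ?thesis by simp
qed

section \<open>Laws of Markov jump processes\<close>

lemma measurable_discrete_iff_borel:
  "f \<in> measurable M (count_space UNIV) \<longleftrightarrow> f \<in> measurable M (borel :: 's::countable discrete measure)"
  by (intro iffI; erule measurable_cong_sets[THEN equalityD1, THEN subsetD, rotated -1])
     (auto intro: borel_open open_discrete)

text \<open>
  Right-continuity makes the process jointly measurable: it is the limit of its values at the next
  point of the grid of mesh \<open>1 / (n + 1)\<close> strictly to the right, and these depend on the time through
  a countable index.  The time is replaced by its positive part because nothing is known about the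
  process at negative times.
\<close>

lemma right_continuous_measurable_pair:
  fixes X :: "real \<Rightarrow> 'w \<Rightarrow> 's::countable discrete"
  assumes X: "\<And>t. 0 \<le> t \<Longrightarrow> X t \<in> measurable M (count_space UNIV)"
    and cont: "\<And>\<omega> t. \<omega> \<in> space M \<Longrightarrow> 0 \<le> t \<Longrightarrow> continuous (at_right t) (\<lambda>s. X s \<omega>)"
  shows "(\<lambda>(s, \<omega>). X (max 0 s) \<omega>) \<in> measurable (lborel \<Otimes>\<^sub>M M) (count_space UNIV)"
proof -
  define \<sigma> where "\<sigma> n s = (real (nat \<lfloor>real (Suc n) * max 0 s\<rfloor>) + 1) / real (Suc n)" for n s
  have "(\<lambda>x. X (\<sigma> n (fst x)) (snd x)) \<in> measurable (lborel \<Otimes>\<^sub>M M) borel" for n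
  proof -
    have "(\<lambda>x. X ((real (nat \<lfloor>real (Suc n) * max 0 (fst x)\<rfloor>) + 1) / real (Suc n)) (snd x))
        \<in> measurable (lborel \<Otimes>\<^sub>M M) (count_space UNIV)"
    proof (rule measurable_compose_countable[where f="\<lambda>k x. X ((real k + 1) / real (Suc n)) (snd x)"])
      show "(\<lambda>x. X ((real k + 1) / real (Suc n)) (snd x)) \<in> measurable (lborel \<Otimes>\<^sub>M M) (count_space UNIV)" for k
        by (rule measurable_compose[OF measurable_snd X]) simp
      show "(\<lambda>x. nat \<lfloor>real (Suc n) * max 0 (fst x)\<rfloor>) \<in> measurable (lborel \<Otimes>\<^sub>M M) (count_space UNIV)"
        by measurable
    qed
    then show ?thesis
      unfolding \<sigma>_def measurable_discrete_iff_borel .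
  qed
  moreover have "(\<lambda>n. X (\<sigma> n (fst x)) (snd x)) \<longlonglongrightarrow> X (max 0 (fst x)) (snd x)"
    if "x \<in> space (lborel \<Otimes>\<^sub>M M)" for x
  proof -
    define t where "t = max 0 (fst x)"
    have t: "0 \<le> t" by (simp add: t_def)
    have \<sigma>: "\<sigma> n (fst x) = (real_of_int \<lfloor>real (Suc n) * t\<rfloor> + 1) / real (Suc n)" for n
      using t by (simp add: \<sigma>_def t_def[symmetric])
    have gt: "t < \<sigma> n (fst x)" for n
      unfolding \<sigma> by (simp add: pos_less_divide_eq mult.commute del: of_nat_Suc)
    have le: "\<sigma> n (fst x) \<le> t + 1 / real (Suc n)" for n
    proof -
      have "(real_of_int \<lfloor>real (Suc n) * t\<rfloor> + 1) / real (Suc n) \<le> (real (Suc n) * t + 1) / real (Suc n)"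
        by (intro divide_right_mono add_right_mono of_int_floor_le) simp
      then show ?thesis unfolding \<sigma> by (simp add: add_divide_distrib del: of_nat_Suc)
    qed
    have "(\<lambda>n. t + 1 / real (Suc n)) \<longlonglongrightarrow> t"
      using tendsto_add[OF tendsto_const LIMSEQ_Suc[OF lim_const_over_n[of 1]], of t] by simp
    then have "(\<lambda>n. \<sigma> n (fst x)) \<longlonglongrightarrow> t"
      by (rule tendsto_sandwich[OF _ _ tendsto_const, rotated 2]) (use gt le in \<open>auto simp: less_imp_le\<close>)
    then have "filterlim (\<lambda>n. \<sigma> n (fst x)) (at_right t) sequentially"
      using gt by (auto simp: filterlim_at less_imp_neq[symmetric] intro!: always_eventually)
    moreover have "((\<lambda>s. X s (snd x)) \<longlongrightarrow> X t (snd x)) (at_right t)"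
      using cont[of "snd x" t] that t by (auto simp: continuous_within space_pair_measure)
    ultimately show ?thesis
      unfolding t_def[symmetric] by (rule filterlim_compose[rotated])
  qed
  ultimately have "(\<lambda>x. X (max 0 (fst x)) (snd x)) \<in> measurable (lborel \<Otimes>\<^sub>M M) borel"
    by (rule borel_measurable_LIMSEQ_metric)
  then show ?thesis by (simp add: measurable_discrete_iff_borel split_beta')
qed

text \<open>
  The Markov property enters only at time \<open>0\<close>, where the process is at \<open>x0\<close> almost surely.
\<close>

lemma markov_jump_process_law:
  fixes X :: "real \<Rightarrow> 'w \<Rightarrow> 's::countable discrete"
  assumes "markov_jump_process L x0 M X"
  obtains P where "semigroup_generated_by L P"
    "\<And>t. 0 \<le> t \<Longrightarrow> distr M (count_space UNIV) (X t) = measure_pmf (P t x0)"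
proof -
  interpret prob_space M using assms by (simp add: markov_jump_process_def)
  have X[measurable]: "\<And>t. 0 \<le> t \<Longrightarrow> X t \<in> measurable M (count_space UNIV)"
    and X0: "AE \<omega> in M. X 0 \<omega> = x0"
    using assms by (auto simp: markov_jump_process_def)
  obtain P where P: "semigroup_generated_by L P"
    and ce: "\<And>s t y. 0 \<le> s \<Longrightarrow> s \<le> t \<Longrightarrow> AE \<omega> in M. real_cond_exp M (natural_filtration M X s)
                         (\<lambda>\<omega>. indicator {y} (X t \<omega>)) \<omega> = pmf (P (t - s) (X s \<omega>)) y"
    using assms unfolding markov_jump_process_def by blast
  have "subalgebra M (natural_filtration M X 0)"
  proof -
    have *: "{X r -` B \<inter> space M | r B. 0 \<le> r \<and> r \<le> 0} \<subseteq> sets M"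
    proof clarify
      fix r :: real and B assume "0 \<le> r" "r \<le> 0"
      then show "X r -` B \<inter> space M \<in> sets M"
        using measurable_sets[OF X, of r B] by simp
    qed
    then show ?thesis
      unfolding subalgebra_def natural_filtration_def
      using sets.sigma_sets_subset[OF *] sets.space_closed
      by (subst sets_measure_of) (auto simp: space_measure_of_conv)
  qed
  then interpret F: finite_measure_subalgebra M "natural_filtration M X 0"
    by unfold_locales
  have "distr M (count_space UNIV) (X t) = measure_pmf (P t x0)" if t: "0 \<le> t" for t
  proof (rule measure_eqI_countable[of _ UNIV])
    fix y
    have m: "(\<lambda>\<omega>. indicator {y} (X t \<omega>) :: real) \<in> borel_measurable M"
      by (rule measurable_compose[OF X[OF t]]) simp
    have int: "integrable M (\<lambda>\<omega>. indicator {y} (X t \<omega>) :: real)"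
      by (rule integrable_const_bound[of _ 1]) (use m in auto)
    have "measure M (X t -` {y} \<inter> space M) = (\<integral>\<omega>. indicator (X t -` {y} \<inter> space M) \<omega> \<partial>M)"
      by simp
    also have "\<dots> = (\<integral>\<omega>. indicator {y} (X t \<omega>) \<partial>M)"
      by (intro Bochner_Integration.integral_cong) (auto split: split_indicator)
    also have "\<dots> = (\<integral>\<omega>. real_cond_exp M (natural_filtration M X 0) (\<lambda>\<omega>. indicator {y} (X t \<omega>)) \<omega> \<partial>M)"
      by (rule F.real_cond_exp_int(2)[OF int, symmetric])
    also have "\<dots> = (\<integral>\<omega>. pmf (P t x0) y \<partial>M)"
    proof (rule integral_cong_AE)
      show "AE \<omega> in M. real_cond_exp M (natural_filtration M X 0) (\<lambda>\<omega>. indicator {y} (X t \<omega>)) \<omega> = pmf (P t x0) y"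
        using ce[of 0 t y] X0 t by auto
    qed auto
    finally have "measure M (X t -` {y} \<inter> space M) = pmf (P t x0) y"
      by (simp add: prob_space)
    then show "emeasure (distr M (count_space UNIV) (X t)) {y} = emeasure (P t x0) {y}"
      using X[OF t] by (subst emeasure_distr) (auto simp: emeasure_eq_measure emeasure_pmf_single)
  qed auto
  then show thesis using P that by blast
qed

lemma markov_jump_process_occupation:
  fixes X :: "real \<Rightarrow> 'w \<Rightarrow> 's::countable discrete" and f :: "'s discrete \<Rightarrow> ennreal"
  assumes X: "markov_jump_process L x0 M X"
    and law: "\<And>t. 0 \<le> t \<Longrightarrow> distr M (count_space UNIV) (X t) = measure_pmf (P t x0)"
  shows "(\<integral>\<^sup>+\<omega>. (\<integral>\<^sup>+s\<in>{0..T}. f (X s \<omega>) \<partial>lborel) \<partial>M) = (\<integral>\<^sup>+s\<in>{0..T}. (\<integral>\<^sup>+y. f y \<partial>P s x0) \<partial>lborel)"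
proof -
  interpret prob_space M using X by (simp add: markov_jump_process_def)
  interpret pair_sigma_finite lborel M ..
  have Xm: "\<And>t. 0 \<le> t \<Longrightarrow> X t \<in> measurable M (count_space UNIV)"
    using X by (auto simp: markov_jump_process_def)
  have [measurable]: "(\<lambda>(s, \<omega>). X (max 0 s) \<omega>) \<in> measurable (lborel \<Otimes>\<^sub>M M) (count_space UNIV)"
    using X by (intro right_continuous_measurable_pair) (auto simp: markov_jump_process_def)
  have fm: "(\<lambda>(s, \<omega>). f (X (max 0 s) \<omega>)) \<in> borel_measurable (lborel \<Otimes>\<^sub>M M)"
    using measurable_compose[OF \<open>(\<lambda>(s, \<omega>). X (max 0 s) \<omega>) \<in> _\<close>, of f borel] by (simp add: split_beta')
  have "(\<integral>\<^sup>+\<omega>. (\<integral>\<^sup>+s\<in>{0..T}. f (X s \<omega>) \<partial>lborel) \<partial>M)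
    = (\<integral>\<^sup>+\<omega>. (\<integral>\<^sup>+s. f (X (max 0 s) \<omega>) * indicator {0..T} s \<partial>lborel) \<partial>M)"
    by (intro nn_integral_cong) (auto split: split_indicator simp: max_def)
  also have "\<dots> = (\<integral>\<^sup>+s. (\<integral>\<^sup>+\<omega>. f (X (max 0 s) \<omega>) * indicator {0..T} s \<partial>M) \<partial>lborel)"
    using fm by (intro Fubini') (simp add: split_beta')
  also have "\<dots> = (\<integral>\<^sup>+s\<in>{0..T}. (\<integral>\<^sup>+y. f y \<partial>P s x0) \<partial>lborel)"
  proof (intro nn_integral_cong)
    fix s
    show "(\<integral>\<^sup>+\<omega>. f (X (max 0 s) \<omega>) * indicator {0..T} s \<partial>M) = (\<integral>\<^sup>+y. f y \<partial>P s x0) * indicator {0..T} s"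
    proof (cases "s \<in> {0..T}")
      case True
      then have s: "0 \<le> s" by simp
      have "(\<integral>\<^sup>+y. f y \<partial>P s x0) = (\<integral>\<^sup>+\<omega>. f (X s \<omega>) \<partial>M)"
        unfolding law[OF s, symmetric] using Xm[OF s] by (subst nn_integral_distr) auto
      then show ?thesis using True by (simp add: max_def)
    qed simp
  qed
  finally show ?thesis .
qed

section \<open>Self-transport plans\<close>

lemma expectation_bind_bounded:
  fixes f :: "'a \<Rightarrow> real"
  assumes f: "\<And>x. \<bar>f x\<bar> \<le> B"
  shows "(\<integral>x. f x \<partial>bind_pmf p K) = (\<integral>x. (\<integral>y. f y \<partial>K x) \<partial>p)"
proof -
  have int: "integrable (measure_pmf r) f" for r
    by (rule measure_pmf.integrable_const_bound[of _ B]) (use f in auto)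
  have E: "\<bar>\<integral>y. f y \<partial>r\<bar> \<le> B" for r :: "'a pmf"
    using integral_mono[OF integrable_abs[OF int] measure_pmf.integrable_const, of r B] f
    by (intro order_trans[OF integral_abs_bound]) auto
  have intE: "integrable p (\<lambda>x. \<integral>y. f y \<partial>K x)"
    by (rule measure_pmf.integrable_const_bound[of _ B]) (use E in auto)
  have fB: "0 \<le> f x + B" and EB: "0 \<le> (\<integral>y. f y \<partial>r) + B" for x and r :: "'a pmf"
    using f[of x] E[of r] by linarith+
  have nn: "(\<integral>\<^sup>+x. ennreal (f x + B) \<partial>r) = ennreal ((\<integral>x. f x \<partial>r) + B)" for r :: "'a pmf"
    by (subst nn_integral_eq_integral) (use int fB in auto)
  have "ennreal ((\<integral>x. f x \<partial>bind_pmf p K) + B) = (\<integral>\<^sup>+x. ennreal ((\<integral>y. f y \<partial>K x) + B) \<partial>p)"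
    unfolding nn[symmetric] by simp
  also have "\<dots> = ennreal ((\<integral>x. (\<integral>y. f y \<partial>K x) \<partial>p) + B)"
    by (subst nn_integral_eq_integral) (use intE EB in auto)
  finally show ?thesis
    using EB[of "bind_pmf p K"]
      Bochner_Integration.integral_nonneg[where f="\<lambda>x. (\<integral>y. f y \<partial>K x) + B" and M=p] EB intE
    by (subst (asm) ennreal_inj) auto
qed

lemma jump_rate_kernel_sets:
  "jump_rate_kernel U q \<Longrightarrow> u \<in> U \<Longrightarrow> sets (q x u) = UNIV"
  by (simp add: jump_rate_kernel_def)

lemma jump_rate_kernel_space:
  "jump_rate_kernel U q \<Longrightarrow> u \<in> U \<Longrightarrow> space (q x u) = UNIV"
  using sets_eq_imp_space_eq[of "q x u" "count_space UNIV"] by (simp add: jump_rate_kernel_sets)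

lemma jump_rate_kernel_borel_measurable:
  fixes f :: "'s::countable discrete \<Rightarrow> 'b::topological_space"
  shows "jump_rate_kernel U q \<Longrightarrow> u \<in> U \<Longrightarrow> f \<in> borel_measurable (q x u)"
  by (simp add: measurable_def jump_rate_kernel_sets jump_rate_kernel_space)

text \<open>
  On a countable state space the generator is an integral over the states of a density that depends
  measurably on \<open>(t, u)\<close>, so joint measurability reduces to that of the rates in \<open>u\<close> and of \<open>f\<close> in \<open>t\<close>.
\<close>

lemma gen_measurable:
  fixes q :: "'s::countable discrete \<Rightarrow> 'u::euclidean_space \<Rightarrow> 's discrete measure"
  assumes q: "jump_rate_kernel U q" and fin: "\<And>x u. u \<in> U \<Longrightarrow> emeasure (q x u) UNIV \<le> ennreal R"
    and f: "\<And>x. (\<lambda>t. f t x) \<in> borel_measurable M"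
  shows "(\<lambda>(t, x, u). gen q u (f t) x) \<in> borel_measurable (M \<Otimes>\<^sub>M state_control_space U)"
proof -
  let ?N = "M \<Otimes>\<^sub>M state_control_space U"
  have [measurable]: "(\<lambda>t. f t x) \<in> borel_measurable M" for x by (rule f)
  have [measurable]: "(\<lambda>z. emeasure (q x (snd (snd z))) {y}) \<in> borel_measurable ?N" for x y
  proof -
    have "(\<lambda>(x, u). emeasure (q x u) {y}) \<in> borel_measurable (state_control_space U)"
      using q by (simp add: jump_rate_kernel_def)
    moreover have "(\<lambda>z. (x, snd (snd z))) \<in> measurable ?N (state_control_space U)"
      by measurable
    ultimately show ?thesis
      using measurable_compose[of "\<lambda>z. (x, snd (snd z))" ?N "state_control_space U"
          "\<lambda>(x, u). emeasure (q x u) {y}" borel] by simp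
  qed
  have eq: "gen q u g x = (\<integral>y. measure (q x u) {y} * (g y - g x) \<partial>count_space UNIV)"
    if "u \<in> U" for x u and g :: "'s discrete \<Rightarrow> real"
  proof -
    interpret finite_measure "q x u"
      using fin[OF that, of x] jump_rate_kernel_space[OF q that, of x]
      by (intro finite_measureI) (auto simp: top_unique)
    have *: "q x u = density (count_space UNIV) (\<lambda>y. ennreal (measure (q x u) {y}))"
      using countable_measure_eq_density[OF jump_rate_kernel_sets[OF q that], of x]
      by (simp add: emeasure_eq_measure)
    show ?thesis
      unfolding gen_def by (subst *, subst integral_density) auto
  qed
  have "(\<lambda>z. \<integral>y. measure (q x (snd (snd z))) {y} * (f (fst z) y - f (fst z) x) \<partial>count_space UNIV)
      \<in> borel_measurable ?N" for x
  proof (rule sigma_finite_measure.borel_measurable_lebesgue_integral[OF sigma_finite_measure_count_space])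
    have "(\<lambda>w. measure (q x (snd (snd (fst w)))) {snd w} * (f (fst (fst w)) (snd w) - f (fst (fst w)) x))
        \<in> borel_measurable (?N \<Otimes>\<^sub>M count_space UNIV)"
    proof (rule measurable_compose_countable[where g=snd and
          f="\<lambda>y w. measure (q x (snd (snd (fst w)))) {y} * (f (fst (fst w)) y - f (fst (fst w)) x)"])
      show "(\<lambda>w. measure (q x (snd (snd (fst w)))) {y} * (f (fst (fst w)) y - f (fst (fst w)) x))
        \<in> borel_measurable (?N \<Otimes>\<^sub>M count_space UNIV)" for y
        unfolding measure_def by measurable
    qed measurable
    then show "(\<lambda>(z, y). measure (q x (snd (snd z))) {y} * (f (fst z) y - f (fst z) x))
        \<in> borel_measurable (?N \<Otimes>\<^sub>M count_space UNIV)" by (simp add: split_beta')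
  qed
  then have "(\<lambda>z. \<integral>y. measure (q (fst (snd z)) (snd (snd z))) {y} * (f (fst z) y - f (fst z) (fst (snd z))) \<partial>count_space UNIV)
      \<in> borel_measurable ?N"
    by (rule measurable_compose_countable[where g="\<lambda>z. fst (snd z)"]) measurable
  then show ?thesis
    by (rule measurable_cong[THEN iffD1, rotated]) (auto simp: eq space_pair_measure space_restrict_space)
qed

text \<open>
  Bounded rates and the moment bound on the kernel make the generator act boundedly on functions that
  are dominated by \<open>w\<close>.  It is used with \<open>w = 1 + V\<close> for \<open>h\<close> and with \<open>w = 1\<close> for bounded functions.
\<close>

lemma gen_bound:
  fixes q :: "'s::countable discrete \<Rightarrow> 'u::euclidean_space \<Rightarrow> 's discrete measure"
  assumes q: "jump_rate_kernel U q" and u: "u \<in> U" and fin: "emeasure (q x u) UNIV \<le> ennreal R" "0 \<le> R"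
    and w: "\<And>x. 0 \<le> w x" and mom: "(\<integral>\<^sup>+y. ennreal (w y) \<partial>q x u) \<le> ennreal (\<kappa> * w x)" "0 \<le> \<kappa>"
    and f: "\<And>x. \<bar>f x\<bar> \<le> k * w x" and k: "0 \<le> k"
  shows "integrable (q x u) w" "integrable (q x u) f" "\<bar>gen q u f x\<bar> \<le> k * (\<kappa> + R) * w x"
proof -
  interpret finite_measure "q x u"
    using fin jump_rate_kernel_space[OF q u, of x]
    by (intro finite_measureI) (auto simp: top_unique)
  note m = jump_rate_kernel_borel_measurable[OF q u]
  show w': "integrable (q x u) w"
    using w mom(1) m by (intro integrableI_nonneg) (auto simp: le_less_trans)
  then have kw: "integrable (q x u) (\<lambda>y. k * w y)" by simp
  show f': "integrable (q x u) f"
    using f by (intro Bochner_Integration.integrable_bound[OF kw] m AE_I2)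
      (auto intro: order_trans[OF _ abs_ge_self])
  have "\<bar>gen q u f x\<bar> \<le> (\<integral>y. \<bar>f y - f x\<bar> \<partial>q x u)"
    unfolding gen_def by (rule integral_abs_bound)
  also have "\<dots> \<le> (\<integral>y. k * w y + k * w x \<partial>q x u)"
  proof (rule integral_mono)
    show "\<bar>f y - f x\<bar> \<le> k * w y + k * w x" for y using f[of x] f[of y] by linarith
  qed (use f' kw in auto)
  also have "\<dots> = k * (\<integral>y. w y \<partial>q x u) + k * w x * measure (q x u) UNIV"
    using w' by (simp add: jump_rate_kernel_space[OF q u])
  also have "\<dots> \<le> k * (\<kappa> * w x) + k * w x * R"
  proof (intro add_mono mult_left_mono)
    have "ennreal (\<integral>y. w y \<partial>q x u) \<le> ennreal (\<kappa> * w x)"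
      using mom(1) w' w by (subst nn_integral_eq_integral[symmetric]) auto
    then show "(\<integral>y. w y \<partial>q x u) \<le> \<kappa> * w x"
      using w[of x] mom(2) by (simp add: ennreal_le_iff)
    show "measure (q x u) UNIV \<le> R"
      using fin by (simp add: emeasure_eq_measure)
  qed (use w[of x] k in auto)
  finally show "\<bar>gen q u f x\<bar> \<le> k * (\<kappa> + R) * w x" by (simp add: algebra_simps)
qed

lemma self_transport_plan_mass:
  assumes "self_transport_plan U q V T \<nu> \<pi>" and T: "0 \<le> T"
  shows "space \<pi> = {0..T} \<times> UNIV \<times> U" "emeasure \<pi> (space \<pi>) = ennreal T"
proof -
  have sets: "sets \<pi> = sets (restrict_space lborel {0..T} \<Otimes>\<^sub>M state_control_space U)"
    using assms by (simp add: self_transport_plan_def)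
  show sp: "space \<pi> = {0..T} \<times> UNIV \<times> U"
    using sets_eq_imp_space_eq[OF sets] by (simp add: space_pair_measure space_restrict_space)
  obtain k where k: "k \<in> measurable (restrict_space lborel {0..T}) (prob_algebra (state_control_space U))"
    and em: "\<And>B. B \<in> sets \<pi> \<Longrightarrow> emeasure \<pi> B =
           (\<integral>\<^sup>+t. emeasure (k t) (Pair t -` B) \<partial>restrict_space lborel {0..T})"
    using assms unfolding self_transport_plan_def by blast
  have "emeasure \<pi> (space \<pi>) = (\<integral>\<^sup>+t. emeasure (k t) (Pair t -` space \<pi>) \<partial>restrict_space lborel {0..T})"
    by (rule em) simp
  also have "\<dots> = (\<integral>\<^sup>+t. 1 \<partial>restrict_space lborel {0..T})"
  proof (rule nn_integral_cong)
    fix t assume t: "t \<in> space (restrict_space lborel {0..T})"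
    then have *: "sets (k t) = sets (state_control_space U)" "prob_space (k t)"
      using measurable_space[OF k t] by (auto simp: space_prob_algebra)
    have "Pair t -` space \<pi> = space (k t)"
      using t sets_eq_imp_space_eq[OF *(1)] by (auto simp: sp space_pair_measure space_restrict_space)
    then show "emeasure (k t) (Pair t -` space \<pi>) = 1"
      using prob_space.emeasure_space_1[OF *(2)] by simp
  qed
  also have "\<dots> = ennreal T"
    using T by (simp add: emeasure_restrict_space space_restrict_space)
  finally show "emeasure \<pi> (space \<pi>) = ennreal T" .
qed

lemma uniformly_continuous_on_discrete:
  fixes \<phi> :: "'s discrete \<Rightarrow> real"
  shows "uniformly_continuous_on (S \<times> UNIV) (\<lambda>(t::real, x). \<phi> x)"
proof -
  have "x = x'" if "dist (t, x) (t' :: real, x' :: 's discrete) < 1" for t x t' x'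
    using le_less_trans[OF dist_snd_le that] by (auto simp: dist_discrete_def split: if_splits)
  then show ?thesis
    unfolding uniformly_continuous_on_def by (intro allI impI exI[of _ 1]) fastforce
qed

text \<open>
  Test functions that do not depend on time give \<open>\<integral> gen q u f x d\<pi> = 0\<close> for bounded \<open>f\<close>, since both
  end marginals are \<open>\<nu>\<close>.  The function \<open>h\<close> is reached by truncation, with \<open>1 + V\<close> as dominating
  function twice: against \<open>q x u\<close> for the convergence of the generators, and against \<open>\<pi>\<close> for the
  convergence of their integrals.
\<close>

lemma transport_cost_ge:
  fixes q :: "'s::countable discrete \<Rightarrow> 'u::euclidean_space \<Rightarrow> 's discrete measure"
  assumes q: "jump_rate_kernel U q" and V: "\<And>x. 0 \<le> V x"
    and fin: "\<And>x u. u \<in> U \<Longrightarrow> emeasure (q x u) UNIV \<le> ennreal R" "0 \<le> R"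
    and mom: "\<And>x u. u \<in> U \<Longrightarrow> (\<integral>\<^sup>+y. ennreal (1 + V y) \<partial>q x u) \<le> ennreal (\<kappa> * (1 + V x))" "0 \<le> \<kappa>"
    and h: "\<And>x. \<bar>h x\<bar> \<le> k * (1 + V x)" and k: "0 \<le> k"
    and ineq: "\<And>x u. u \<in> U \<Longrightarrow> g + gen q u h x \<le> c x u"
    and plan: "self_transport_plan U q V T \<nu> \<pi>" and T: "0 \<le> T"
  shows "ereal (T * g) \<le> enn2ereal (\<integral>\<^sup>+(t, x, u). ennreal (c x u) \<partial>\<pi>)"
proof -
  note sp = self_transport_plan_mass[OF plan T]
  interpret \<pi>: finite_measure \<pi> using sp(2) by (intro finite_measureI) simp
  have sets: "sets \<pi> = sets (restrict_space lborel {0..T} \<Otimes>\<^sub>M state_control_space U)"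
    using plan by (simp add: self_transport_plan_def)
  define w where "w x = 1 + V x" for x
  have w: "0 \<le> w x" for x using V[of x] by (simp add: w_def)
  define \<phi> where "\<phi> n x = max (- real n) (min (real n) (h x))" for n x
  have \<phi>h: "\<bar>\<phi> n x\<bar> \<le> \<bar>h x\<bar>" and \<phi>n: "\<bar>\<phi> n x\<bar> \<le> real n" for n x by (auto simp: \<phi>_def)
  have \<phi>w: "\<bar>\<phi> n x\<bar> \<le> k * w x" for n x using \<phi>h[of n x] h[of x] by (simp add: w_def)
  have hw: "\<bar>h x\<bar> \<le> k * w x" for x using h by (simp add: w_def)
  have \<phi>_lim: "(\<lambda>n. \<phi> n x) \<longlonglongrightarrow> h x" for x
  proof -
    have "\<forall>\<^sub>F n in sequentially. \<phi> n x = h x"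
      using eventually_ge_at_top[of "nat \<lceil>\<bar>h x\<bar>\<rceil>"] 
      by eventually_elim (auto simp: \<phi>_def nat_le_iff ceiling_le_iff)
    then show ?thesis by (rule tendsto_eventually)
  qed
  define G where "G f = (\<lambda>(t::real, x, u). gen q u f x)" for f
  have Gm: "G f \<in> borel_measurable \<pi>" for f
    using gen_measurable[OF q fin(1), of "\<lambda>_. f" "restrict_space lborel {0..T}"]
    unfolding G_def by (simp add: measurable_cong_sets[OF sets refl])
  have Gb: "\<bar>G f z\<bar> \<le> k * (\<kappa> + R) * w (fst (snd z))"
    if "z \<in> space \<pi>" "\<And>x. \<bar>f x\<bar> \<le> k * w x" for f z
    using gen_bound(3)[OF q _ fin(1) fin(2) w mom(1)[folded w_def] mom(2) that(2) k] that(1)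
    by (auto simp: G_def sp)
  have zero: "(\<integral>z. G (\<phi> n) z \<partial>\<pi>) = 0" for n
  proof -
    have "test_function T (\<lambda>_. \<phi> n) (\<lambda>_ _. 0)"
      unfolding test_function_def
      using uniformly_continuous_on_discrete[of "{0..T}" "\<phi> n"]
        uniformly_continuous_on_discrete[of "{0..T}" "\<lambda>_. 0"]
      by (auto simp: bounded_iff split_beta' intro!: exI[of _ "real n"] \<phi>n)
    then have "measure_pmf.expectation \<nu> (\<lambda>x. \<phi> n x - \<phi> n x) = (\<integral>(t, x, u). (0 + gen q u (\<phi> n) x) \<partial>\<pi>)"
      using plan unfolding self_transport_plan_def by blast
    then show ?thesis by (simp add: G_def)
  qed
  have wint: "integrable \<pi> (\<lambda>z. k * (\<kappa> + R) * w (fst (snd z)))"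
  proof -
    have "(\<integral>\<^sup>+z. ennreal (w (fst (snd z))) \<partial>\<pi>) < \<infinity>"
      using plan by (simp add: self_transport_plan_def w_def split_beta')
    moreover have "(\<lambda>z. w (fst (snd z))) \<in> borel_measurable \<pi>"
      unfolding measurable_cong_sets[OF sets refl] by measurable
    ultimately have "integrable \<pi> (\<lambda>z. w (fst (snd z)))"
      using w by (intro integrableI_nonneg) auto
    then show ?thesis by simp
  qed
  have conv: "(\<lambda>n. G (\<phi> n) z) \<longlonglongrightarrow> G h z" if z: "z \<in> space \<pi>" for z
  proof -
    obtain t x u where zz: "z = (t, x, u)" by (cases z) auto
    then have u: "u \<in> U" using z by (simp add: sp)
    interpret finite_measure "q x u"
      using fin(1)[OF u, of x] jump_rate_kernel_space[OF q u, of x]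
      by (intro finite_measureI) (auto simp: top_unique)
    have "integrable (q x u) w"
      using gen_bound(1)[OF q u fin(1)[OF u] fin(2) w mom(1)[OF u, folded w_def] mom(2) hw k] .
    then have "(\<lambda>n. \<integral>y. (\<phi> n y - \<phi> n x) \<partial>q x u) \<longlonglongrightarrow> (\<integral>y. (h y - h x) \<partial>q x u)"
    proof (intro integral_dominated_convergence[where w="\<lambda>y. k * w y + k * w x"])
      show "AE y in q x u. norm (\<phi> n y - \<phi> n x) \<le> k * w y + k * w x" for n
        using \<phi>w[of n x] \<phi>w[of n] by (intro AE_I2) (smt (verit) real_norm_def)
      show "AE y in q x u. (\<lambda>n. \<phi> n y - \<phi> n x) \<longlonglongrightarrow> h y - h x"
        by (intro AE_I2 tendsto_diff \<phi>_lim)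
    qed (auto intro: jump_rate_kernel_borel_measurable[OF q u])
    then show ?thesis by (simp add: zz G_def gen_def)
  qed
  have "(\<lambda>n. \<integral>z. G (\<phi> n) z \<partial>\<pi>) \<longlonglongrightarrow> (\<integral>z. G h z \<partial>\<pi>)"
    by (rule integral_dominated_convergence[OF Gm Gm wint]) (use conv Gb \<phi>w in auto)
  then have Gh0: "(\<integral>z. G h z \<partial>\<pi>) = 0"
    unfolding zero by (simp add: LIMSEQ_const_iff)
  have Ghint: "integrable \<pi> (G h)"
    by (rule Bochner_Integration.integrable_bound[OF wint Gm]) (use Gb hw in \<open>auto intro!: AE_I2 intro: order_trans[OF _ abs_ge_self]\<close>)
  have "T * g = (\<integral>z. g + G h z \<partial>\<pi>)"
    using Ghint Gh0 sp(2) T by (simp add: \<pi>.emeasure_eq_measure)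
  also have "\<dots> \<le> (\<integral>z. max 0 (g + G h z) \<partial>\<pi>)"
    using Ghint by (intro integral_mono) auto
  finally have "ereal (T * g) \<le> ereal (\<integral>z. max 0 (g + G h z) \<partial>\<pi>)" by simp
  also have "\<dots> = enn2ereal (ennreal (\<integral>z. max 0 (g + G h z) \<partial>\<pi>))"
    by (simp add: enn2ereal_ennreal)
  also have "ennreal (\<integral>z. max 0 (g + G h z) \<partial>\<pi>) = (\<integral>\<^sup>+z. ennreal (max 0 (g + G h z)) \<partial>\<pi>)"
    using Ghint by (intro nn_integral_eq_integral[symmetric]) auto
  also have "enn2ereal \<dots> \<le> enn2ereal (\<integral>\<^sup>+(t, x, u). ennreal (c x u) \<partial>\<pi>)"
  proof -
    have "(\<integral>\<^sup>+z. ennreal (max 0 (g + G h z)) \<partial>\<pi>) \<le> (\<integral>\<^sup>+(t, x, u). ennreal (c x u) \<partial>\<pi>)"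
      using ineq by (intro nn_integral_mono) (auto simp: sp G_def max_def intro: ennreal_leI)
    then show ?thesis by (simp add: less_eq_ennreal.rep_eq)
  qed
  finally show ?thesis .
qed

text \<open>
  The plan that keeps the state at the invariant law \<open>\<nu>\<close> and uses the control \<open>\<mu>\<close> throughout.  The time
  derivative integrates to the difference of the end values for each state, and the generator term
  vanishes for each time by invariance.
\<close>

lemma stationary_plan:
  fixes q :: "'s::countable discrete \<Rightarrow> 'u::euclidean_space \<Rightarrow> 's discrete measure"
    and K :: "'s discrete \<Rightarrow> 's discrete pmf"
  assumes q: "jump_rate_kernel U q" and V: "\<And>x. 0 \<le> V x"
    and fin: "\<And>x u. u \<in> U \<Longrightarrow> emeasure (q x u) UNIV \<le> ennreal R" "0 \<le> R"
    and \<mu>: "\<And>x. \<mu> x \<in> U"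
    and K: "\<And>x (f :: _ \<Rightarrow> real). integrable (q x (\<mu> x)) f \<Longrightarrow> gen_ctrl q \<mu> f x = \<Lambda> * ((\<integral>y. f y \<partial>K x) - f x)"
    and \<nu>: "bind_pmf \<nu> K = \<nu>" and V\<nu>: "(\<integral>\<^sup>+x. ennreal (V x) \<partial>\<nu>) < \<infinity>" and T: "0 \<le> T"
    and c: "(\<lambda>(x, u). ennreal (c x u)) \<in> borel_measurable (state_control_space U)"
  obtains \<pi> where "self_transport_plan U q V T \<nu> \<pi>"
    "(\<integral>\<^sup>+(t, x, u). ennreal (c x u) \<partial>\<pi>) = ennreal T * (\<integral>\<^sup>+x. ennreal (c x (\<mu> x)) \<partial>\<nu>)"
proof -
  let ?S = "state_control_space U" and ?L = "restrict_space lborel {0..T}"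
  have sm[measurable]: "(\<lambda>x. (x, \<mu> x)) \<in> measurable (measure_pmf \<nu>) ?S"
    using \<mu> by (simp add: measurable_def sets_eq_imp_space_eq[OF sets_measure_pmf_count_space]
        space_pair_measure space_restrict_space)
  define D where "D = distr \<nu> ?S (\<lambda>x. (x, \<mu> x))"
  have sD[measurable_cong]: "sets D = sets ?S" by (simp add: D_def)
  have spD: "space D = UNIV \<times> U"
    using sets_eq_imp_space_eq[OF sD] by (simp add: space_pair_measure space_restrict_space)
  interpret D: prob_space D
    unfolding D_def by (rule measure_pmf.prob_space_distr[OF sm])
  define \<pi> where "\<pi> = ?L \<Otimes>\<^sub>M D"
  have L: "emeasure ?L {0..T} = ennreal T"
    using T by (simp add: emeasure_restrict_space)
  interpret L: finite_measure ?L
    using L by (intro finite_measureI) (simp add: space_restrict_space)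
  interpret LD: pair_sigma_finite ?L D ..
  interpret \<pi>: finite_measure \<pi>
    unfolding \<pi>_def by (intro finite_measure_pair_measure) unfold_locales
  have s\<pi>: "sets \<pi> = sets (?L \<Otimes>\<^sub>M ?S)"
    unfolding \<pi>_def by (rule sets_pair_measure_cong) (simp_all add: sD)
  have sp\<pi>: "space \<pi> = {0..T} \<times> UNIV \<times> U"
    by (simp add: \<pi>_def space_pair_measure spD space_restrict_space)
  have nnD: "(\<integral>\<^sup>+z. f z \<partial>D) = (\<integral>\<^sup>+x. f (x, \<mu> x) \<partial>\<nu>)" if "f \<in> borel_measurable ?S" for f :: "_ \<Rightarrow> ennreal"
    unfolding D_def using that by (subst nn_integral_distr[OF sm]) simp_all
  have nn\<pi>: "(\<integral>\<^sup>+z. f (snd z) \<partial>\<pi>) = ennreal T * (\<integral>\<^sup>+x. f (x, \<mu> x) \<partial>\<nu>)"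
    if f[measurable]: "f \<in> borel_measurable ?S" for f :: "_ \<Rightarrow> ennreal"
  proof -
    have "(\<lambda>z. f (snd z)) \<in> borel_measurable (?L \<Otimes>\<^sub>M D)" by measurable
    then have "(\<integral>\<^sup>+z. f (snd z) \<partial>\<pi>) = (\<integral>\<^sup>+t. (\<integral>\<^sup>+z. f z \<partial>D) \<partial>?L)"
      unfolding \<pi>_def by (subst D.nn_integral_fst[symmetric]) auto
    then show ?thesis by (simp add: nnD L mult.commute)
  qed
  have plan: "self_transport_plan U q V T \<nu> \<pi>"
    unfolding self_transport_plan_def
  proof (intro conjI allI impI)
    show "sets \<pi> = sets (?L \<Otimes>\<^sub>M ?S)" by (rule s\<pi>)
    show "\<exists>k m.
        k \<in> measurable ?L (prob_algebra ?S) \<and>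
        (\<forall>B\<in>sets \<pi>. emeasure \<pi> B = (\<integral>\<^sup>+t. emeasure (k t) (Pair t -` B) \<partial>?L)) \<and>
        (AE t in ?L. distr (k t) (count_space UNIV) fst = measure_pmf (m t)) \<and>
        (\<forall>\<phi>::'s discrete \<Rightarrow> real. continuous_on UNIV \<phi> \<and> bounded (range \<phi>) \<longrightarrow>
           continuous_on {0..T} (\<lambda>t. measure_pmf.expectation (m t) \<phi>)) \<and>
        m 0 = \<nu> \<and> m T = \<nu>"
    proof (intro exI[of _ "\<lambda>_. D"] exI[of _ "\<lambda>_. \<nu>"] conjI ballI allI impI)
      show "(\<lambda>_. D) \<in> measurable ?L (prob_algebra ?S)"
        by (rule measurable_const) (simp add: space_prob_algebra sD D.prob_space_axioms)
      show "emeasure \<pi> B = (\<integral>\<^sup>+t. emeasure D (Pair t -` B) \<partial>?L)" if "B \<in> sets \<pi>" for B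
        using that unfolding \<pi>_def by (rule D.emeasure_pair_measure_alt)
      have "distr D (count_space UNIV) fst = distr \<nu> (count_space UNIV) (\<lambda>x. x)"
        unfolding D_def by (subst distr_distr) (simp_all add: o_def sm \<mu> space_pair_measure space_restrict_space)
      also have "\<dots> = measure_pmf \<nu>"
        by (rule distr_id2) simp
      finally show "AE t in ?L. distr D (count_space UNIV) fst = measure_pmf \<nu>" by simp
    qed auto
    show "(\<integral>\<^sup>+(t, x, u). ennreal (1 + V x) \<partial>\<pi>) < \<infinity>"
    proof -
      have "(\<integral>\<^sup>+z. ennreal (1 + V (fst (snd z))) \<partial>\<pi>) = ennreal T * (\<integral>\<^sup>+x. ennreal (1 + V x) \<partial>\<nu>)"
        by (subst nn\<pi>[of "\<lambda>z. ennreal (1 + V (fst z))"]) simp_all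
      also have "(\<integral>\<^sup>+x. ennreal (1 + V x) \<partial>\<nu>) = 1 + (\<integral>\<^sup>+x. ennreal (V x) \<partial>\<nu>)"
        using V by (simp add: nn_integral_add ennreal_plus)
      also have "ennreal T * \<dots> < \<infinity>"
        using V\<nu> by (simp add: ennreal_mult_less_top)
      finally show ?thesis by (simp add: split_beta')
    qed
    fix f f' :: "real \<Rightarrow> 's discrete \<Rightarrow> real" assume tf: "test_function T f f'"
    have fd: "\<And>t x. t \<in> {0..T} \<Longrightarrow> ((\<lambda>s. f s x) has_real_derivative f' t x) (at t within {0..T})"
      using tf by (auto simp: test_function_def)
    have "bounded ((\<lambda>(t, x). f t x) ` ({0..T} \<times> UNIV))" "bounded ((\<lambda>(t, x). f' t x) ` ({0..T} \<times> UNIV))"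
      using tf by (simp_all add: test_function_def)
    then obtain B B' where B: "\<And>t x. t \<in> {0..T} \<Longrightarrow> \<bar>f t x\<bar> \<le> B"
      and B': "\<And>t x. t \<in> {0..T} \<Longrightarrow> \<bar>f' t x\<bar> \<le> B'"
      unfolding bounded_iff by fastforce
    have B0: "0 \<le> B" using B[of 0 undefined] T by simp
    have "uniformly_continuous_on ({0..T} \<times> UNIV) (\<lambda>(t, x). f' t x)"
      using tf by (simp add: test_function_def)
    then have c': "continuous_on ({0..T} \<times> UNIV) (\<lambda>(t, x). f' t x)"
      by (rule uniformly_continuous_imp_continuous)
    have f'c: "continuous_on {0..T} (\<lambda>t. f' t x)" for x
    proof -
      have "continuous_on {0..T} (\<lambda>t. (\<lambda>(t, x). f' t x) (t, x))"
        by (rule continuous_on_compose2[OF c']) (auto intro!: continuous_intros)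
      then show ?thesis by simp
    qed
    have fc: "continuous_on {0..T} (\<lambda>t. f t x)" for x
      by (rule DERIV_continuous_on[OF fd])
    have meas: "(\<lambda>t. g t) \<in> borel_measurable ?L" if "continuous_on {0..T} g" for g :: "real \<Rightarrow> real"
      using borel_measurable_continuous_on_restrict[OF that]
      unfolding measurable_cong_sets[OF sets_restrict_space_cong[OF sets_lborel] refl] .
    have f'm: "(\<lambda>z. f' (fst z) (fst (snd z))) \<in> borel_measurable \<pi>"
      unfolding measurable_cong_sets[OF s\<pi> refl]
    proof (rule measurable_compose_countable[where g="\<lambda>z. fst (snd z)" and f="\<lambda>x z. f' (fst z) x"])
      show "(\<lambda>z. f' (fst z) x) \<in> borel_measurable (?L \<Otimes>\<^sub>M ?S)" for x
        by (rule measurable_compose[OF measurable_fst meas[OF f'c]])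
    qed measurable
    have f'int: "integrable \<pi> (\<lambda>z. f' (fst z) (fst (snd z)))"
      by (rule \<pi>.integrable_const_bound[of _ B']) (use B' f'm in \<open>auto simp: sp\<pi>\<close>)
    have gm: "(\<lambda>(t, x, u). gen q u (f t) x) \<in> borel_measurable \<pi>"
      unfolding measurable_cong_sets[OF s\<pi> refl] by (rule gen_measurable[OF q fin(1) meas[OF fc]])
    have gb: "\<bar>gen q u (f t) x\<bar> \<le> B * (R + R) * 1" if "t \<in> {0..T}" "u \<in> U" for t x u
      using gen_bound(3)[OF q that(2) fin(1)[OF that(2)] fin(2), of "\<lambda>_. 1" x R "f t" B] B[OF that(1)] B0
        fin that(2) jump_rate_kernel_space[OF q that(2), of x] by simp
    have gint: "integrable \<pi> (\<lambda>(t, x, u). gen q u (f t) x)"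
      by (rule \<pi>.integrable_const_bound[of _ "B * (R + R)"]) (use gb gm in \<open>auto simp: sp\<pi>\<close>)
    have intD: "(\<integral>z. g z \<partial>D) = (\<integral>x. g (x, \<mu> x) \<partial>\<nu>)" if "g \<in> borel_measurable ?S" for g :: "_ \<Rightarrow> real"
      unfolding D_def using that by (subst integral_distr[OF sm]) simp_all
    have "(\<integral>(t, x, u). gen q u (f t) x \<partial>\<pi>) = (\<integral>t. (\<integral>(x, u). gen q u (f t) x \<partial>D) \<partial>?L)"
      using LD.integral_fst'[OF gint[unfolded \<pi>_def]] by (simp add: \<pi>_def split_beta')
    also have "\<dots> = (\<integral>t. 0 \<partial>?L)"
    proof (rule Bochner_Integration.integral_cong[OF refl])
      fix t assume "t \<in> space ?L"
      then have t: "t \<in> {0..T}" by (simp add: space_restrict_space)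
      have "(\<lambda>z. (t, z)) \<in> measurable ?S (?L \<Otimes>\<^sub>M ?S)"
        using \<open>t \<in> space ?L\<close> by (rule measurable_Pair1')
      from measurable_compose[OF this gm[unfolded measurable_cong_sets[OF s\<pi> refl]]]
      have "(\<integral>(x, u). gen q u (f t) x \<partial>D) = (\<integral>x. gen_ctrl q \<mu> (f t) x \<partial>\<nu>)"
        by (subst intD) (simp_all add: split_beta' gen_ctrl_def[abs_def])
      also have "\<dots> = (\<integral>x. \<Lambda> * ((\<integral>y. f t y \<partial>K x) - f t x) \<partial>\<nu>)"
      proof (intro Bochner_Integration.integral_cong[OF refl] K)
        fix x
        show "integrable (q x (\<mu> x)) (f t)"
          using gen_bound(2)[OF q \<mu>[of x] fin(1)[OF \<mu>[of x], of x] fin(2), where w="\<lambda>_. 1" and \<kappa>=R and f="f t" and k=B]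
            B[OF t] B0
            fin \<mu> jump_rate_kernel_space[OF q \<mu>, of x] by simp
      qed
      also have "\<dots> = \<Lambda> * ((\<integral>x. (\<integral>y. f t y \<partial>K x) \<partial>\<nu>) - (\<integral>x. f t x \<partial>\<nu>))"
      proof -
        have bi: "integrable (measure_pmf p) (f t)" for p
          by (rule measure_pmf.integrable_const_bound[of _ B]) (use B[OF t] in auto)
        have "\<bar>\<integral>y. f t y \<partial>K x\<bar> \<le> B" for x
          using integral_mono[OF integrable_abs[OF bi] measure_pmf.integrable_const, of "K x" B] B[OF t]
          by (intro order_trans[OF integral_abs_bound]) auto
        then have "integrable \<nu> (\<lambda>x. \<integral>y. f t y \<partial>K x)"
          by (intro measure_pmf.integrable_const_bound[of _ B]) auto
        with bi show ?thesis by simp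
      qed
      also have "\<dots> = 0"
        using expectation_bind_bounded[of "f t" B \<nu> K, OF B[OF t]] \<nu> by simp
      finally show "(\<integral>(x, u). gen q u (f t) x \<partial>D) = 0" .
    qed
    finally have G0: "(\<integral>(t, x, u). gen q u (f t) x \<partial>\<pi>) = 0" by simp
    have "(\<integral>z. f' (fst z) (fst (snd z)) \<partial>\<pi>) = (\<integral>z. (\<integral>t. f' t (fst z) \<partial>?L) \<partial>D)"
      using LD.integral_snd[of "\<lambda>t z. f' t (fst z)"] f'int by (simp add: \<pi>_def split_beta')
    also have "\<dots> = (\<integral>z. f T (fst z) - f 0 (fst z) \<partial>D)"
    proof (rule Bochner_Integration.integral_cong[OF refl])
      fix z
      have "(\<integral>t. f' t (fst z) \<partial>?L) = (\<integral>t. indicator {0..T} t *\<^sub>R f' t (fst z) \<partial>lborel)"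
        by (rule integral_restrict_space) simp
      also have "\<dots> = f T (fst z) - f 0 (fst z)"
        using fd by (intro integral_FTC_atLeastAtMost[OF T _ f'c])
          (auto simp: has_real_derivative_iff_has_vector_derivative)
      finally show "(\<integral>t. f' t (fst z) \<partial>?L) = f T (fst z) - f 0 (fst z)" .
    qed
    also have "\<dots> = (\<integral>x. f T x - f 0 x \<partial>\<nu>)"
      by (subst intD) simp_all
    finally show "measure_pmf.expectation \<nu> (\<lambda>x. f T x - f 0 x) =
          (\<integral>(t, x, u). (f' t x + gen q u (f t) x) \<partial>\<pi>)"
      using G0 Bochner_Integration.integral_add[OF f'int gint] by (simp add: split_beta')
  qed
  have "(\<integral>\<^sup>+(t, x, u). ennreal (c x u) \<partial>\<pi>) = ennreal T * (\<integral>\<^sup>+x. ennreal (c x (\<mu> x)) \<partial>\<nu>)"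
    using nn\<pi>[OF c] by (simp add: split_beta')
  with plan show thesis by (rule that)
qed

section \<open>The common value\<close>

lemma compact_discrete_imp_finite:
  fixes C :: "'s discrete set"
  assumes "compact C"
  shows "finite C"
proof -
  obtain F where "F \<subseteq> C" "finite F" "C \<subseteq> (\<Union>x\<in>F. {x})"
    by (rule compactE_image[OF assms, of C "\<lambda>x. {x}"]) (auto intro: open_discrete)
  then show ?thesis by (auto intro: finite_subset)
qed

lemma finite_sublevel:
  fixes f :: "'s discrete \<Rightarrow> real"
  assumes "relatively_compact_sublevels f"
  shows "finite {x. f x \<le> r}"
  using assms compact_discrete_imp_finite[of "closure {x. f x \<le> r}"] finite_subset[OF closure_subset]
  by (auto simp: relatively_compact_sublevels_def)

lemma lower_semicontinuous_on_borel_measurable: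
  fixes f :: "'a::topological_space \<Rightarrow> real"
  assumes "lower_semicontinuous_on S f"
  shows "f \<in> borel_measurable (restrict_space borel S)"
  unfolding borel_measurable_iff_greater
proof
  fix r
  have "\<exists>T. open T \<and> a \<in> T \<and> (\<forall>b\<in>T \<inter> S. r < f b)" if "a \<in> S" "r < f a" for a
  proof -
    have "eventually (\<lambda>b. r < f b) (at a within S)"
      using assms that by (auto simp: lower_semicontinuous_on_def)
    then obtain T where "open T" "a \<in> T" "\<forall>b\<in>T. b \<noteq> a \<longrightarrow> b \<in> S \<longrightarrow> r < f b"
      unfolding eventually_at_topological by blast
    then show ?thesis using that(2) by (intro exI[of _ T]) auto
  qed
  then obtain T where T: "\<And>a. a \<in> S \<Longrightarrow> r < f a \<Longrightarrow> open (T a) \<and> a \<in> T a \<and> (\<forall>b\<in>T a \<inter> S. r < f b)"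
    by metis
  then have "open (\<Union>a\<in>{a\<in>S. r < f a}. T a)" by auto
  moreover have "{a\<in>S. r < f a} = S \<inter> (\<Union>a\<in>{a\<in>S. r < f a}. T a)"
    using T by blast
  ultimately show "{w \<in> space (restrict_space borel S). r < f w} \<in> sets (restrict_space borel S)"
    by (auto simp: space_restrict_space sets_restrict_space)
qed

text \<open>
  These two lemmas move the optimality inequality from the reals, where it involves a difference, to
  the extended nonnegative reals, where the accumulated cost is estimated.
\<close>

lemma cost_potential_ennreal_ge:
  assumes "0 \<le> g" "0 < \<Lambda>" "\<And>x. 0 \<le> \<Psi> x" "integrable (measure_pmf p) \<Psi>"
    and "g \<le> \<Lambda> * ((\<integral>y. \<Psi> y \<partial>p) - \<Psi> x) + c" "0 \<le> c"
  shows "ennreal g + ennreal \<Lambda> * ennreal (\<Psi> x) \<le> ennreal \<Lambda> * (\<integral>\<^sup>+y. ennreal (\<Psi> y) \<partial>p) + ennreal c"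
proof -
  have I: "0 \<le> (\<integral>y. \<Psi> y \<partial>p)" using assms(3) by simp
  have "(\<integral>\<^sup>+y. ennreal (\<Psi> y) \<partial>p) = ennreal (\<integral>y. \<Psi> y \<partial>p)"
    using assms by (intro nn_integral_eq_integral) auto
  then show ?thesis
    using assms I
    by (simp add: ennreal_mult[symmetric] ennreal_plus[symmetric] algebra_simps del: ennreal_plus)
qed

lemma cost_potential_ennreal_le:
  assumes "0 \<le> g" "0 < \<Lambda>" "\<And>x. 0 \<le> \<Psi> x" "integrable (measure_pmf p) \<Psi>"
    and "\<Lambda> * ((\<integral>y. \<Psi> y \<partial>p) - \<Psi> x) + c \<le> g" "0 \<le> c"
  shows "ennreal \<Lambda> * (\<integral>\<^sup>+y. ennreal (\<Psi> y) \<partial>p) + ennreal c \<le> ennreal g + ennreal \<Lambda> * ennreal (\<Psi> x)"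
proof -
  have I: "0 \<le> (\<integral>y. \<Psi> y \<partial>p)" using assms(3) by simp
  have "(\<integral>\<^sup>+y. ennreal (\<Psi> y) \<partial>p) = ennreal (\<integral>y. \<Psi> y \<partial>p)"
    using assms by (intro nn_integral_eq_integral) auto
  then show ?thesis
    using assms I
    by (simp add: ennreal_mult[symmetric] ennreal_plus[symmetric] algebra_simps del: ennreal_plus)
qed

lemma Limsup_average_le:
  assumes "0 \<le> g" "0 \<le> B" and J: "\<And>T. 0 < T \<Longrightarrow> J T \<le> ennreal (T * g + B)"
  shows "Limsup at_top (\<lambda>T::real. ereal (1 / T) * enn2ereal (J T)) \<le> ereal g"
proof -
  have "\<forall>\<^sub>F T in at_top. ereal (1 / T) * enn2ereal (J T) \<le> ereal (g + B / T)"
    using eventually_gt_at_top[of "0::real"]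
  proof eventually_elim
    case (elim T)
    have "enn2ereal (J T) \<le> ereal (T * g + B)"
      using J[OF elim] assms(1,2) elim
      by (simp add: less_eq_ennreal.rep_eq enn2ereal_ennreal del: ennreal_plus)
    then have "ereal (1 / T) * enn2ereal (J T) \<le> ereal (1 / T) * ereal (T * g + B)"
      using elim by (intro ereal_mult_left_mono) auto
    also have "\<dots> = ereal (g + B / T)" using elim by (simp add: field_simps)
    finally show ?case .
  qed
  then have "Limsup at_top (\<lambda>T::real. ereal (1 / T) * enn2ereal (J T)) \<le> Limsup at_top (\<lambda>T. ereal (g + B / T))"
    by (rule Limsup_mono)
  also have "((\<lambda>T. g + B / T) \<longlongrightarrow> g + 0) at_top"
    by (intro tendsto_intros tendsto_divide_0[OF tendsto_const] filterlim_at_top_imp_at_infinity filterlim_ident)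
  then have "Limsup at_top (\<lambda>T. ereal (g + B / T)) = ereal g"
    by (intro lim_imp_Limsup) auto
  finally show ?thesis .
qed

lemma Limsup_average_ge:
  assumes "0 \<le> g" "0 \<le> B" and J: "\<And>T. 0 < T \<Longrightarrow> ennreal (T * g) \<le> ennreal B + J T"
  shows "ereal g \<le> Limsup at_top (\<lambda>T::real. ereal (1 / T) * enn2ereal (J T))"
proof -
  have "((\<lambda>T. g - B / T) \<longlongrightarrow> g - 0) at_top"
    by (intro tendsto_intros tendsto_divide_0[OF tendsto_const] filterlim_at_top_imp_at_infinity filterlim_ident)
  then have "ereal g = Limsup at_top (\<lambda>T. ereal (g - B / T))"
    by (intro lim_imp_Limsup[symmetric]) auto
  also have "\<forall>\<^sub>F T in at_top. ereal (g - B / T) \<le> ereal (1 / T) * enn2ereal (J T)"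
    using eventually_gt_at_top[of "0::real"]
  proof eventually_elim
    case (elim T)
    have "ereal (T * g - B) \<le> enn2ereal (J T)"
    proof (cases "J T")
      case (real j)
      then show ?thesis
        using J[OF elim] assms elim
        by (simp add: ennreal_plus[symmetric] ennreal_le_iff enn2ereal_ennreal del: ennreal_plus)
    qed simp
    then have "ereal (1 / T) * ereal (T * g - B) \<le> ereal (1 / T) * enn2ereal (J T)"
      using elim by (intro ereal_mult_left_mono) auto
    moreover have "ereal (1 / T) * ereal (T * g - B) = ereal (g - B / T)"
      using elim by (simp add: field_simps)
    ultimately show ?case by simp
  qed
  then have "Limsup at_top (\<lambda>T. ereal (g - B / T)) \<le> Limsup at_top (\<lambda>T::real. ereal (1 / T) * enn2ereal (J T))"
    by (rule Limsup_mono)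
  finally show ?thesis .
qed

theorem theorem3p5:
  fixes U :: "'u::euclidean_space set"
    and q :: "'s::countable discrete \<Rightarrow> 'u \<Rightarrow> 's discrete measure"
    and A :: "('s discrete \<Rightarrow> 'u) set"
    and V W h :: "'s discrete \<Rightarrow> real"
    and C :: "'s discrete set"
    and b gstar :: real
    and c :: "'s discrete \<Rightarrow> 'u \<Rightarrow> real"
    and ustar :: "'s discrete \<Rightarrow> 'u"
  assumes U: "compact U"
    and q: "jump_rate_kernel U q"
    and controls: "\<And>\<mu> x. \<mu> \<in> A \<Longrightarrow> \<mu> x \<in> U"
    and V: "\<And>x. V x \<ge> 0" "relatively_compact_sublevels V"
    and W: "\<And>x. W x \<ge> 1"
    and C: "compact C"
    and stability_irreducible: "\<And>\<mu>. \<mu> \<in> A \<Longrightarrow> generates_irreducible (gen_ctrl q \<mu>)"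
    and stability_drift: "\<And>\<mu> x. \<mu> \<in> A \<Longrightarrow> gen_ctrl q \<mu> V x \<le> - W x + b * indicator C x"
    and cost: "\<And>x u. u \<in> U \<Longrightarrow> 0 \<le> c x u" "\<And>x u. u \<in> U \<Longrightarrow> c x u \<le> W x"
    and cost_lsc: "\<And>x. lower_semicontinuous_on U (c x)"
    and cost_convex: "\<And>x. convex_on U (c x)"
    and U_convex: "convex U"
    and gen_affine: "\<And>f x. f \<in> core \<Longrightarrow> affine_on U (\<lambda>u. gen q u f x)"
    and rates_bounded: "(SUP (x, u)\<in>UNIV \<times> U. emeasure (q x u) UNIV) < \<infinity>"
    and rates_V: "\<exists>\<kappa>::real. \<forall>x.
      (SUP u\<in>U. \<integral>\<^sup>+y. ennreal (1 + V y) \<partial>q x u) \<le> ennreal (\<kappa> * (1 + V x))"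
    and h_norm: "bdd_above (range (\<lambda>x. \<bar>h x\<bar> / (1 + V x)))"
    and ustar: "\<And>x. is_arg_max (\<lambda>u. gen q u h x - c x u) (\<lambda>u. u \<in> U) (ustar x)"
    and hjb: "\<And>x. gstar + gen_ctrl q ustar h x = c x (ustar x)"
    and cost_coercive: "relatively_compact_sublevels (\<lambda>x. INF u\<in>U. c x u)"
    and cost_locally_bounded:
      "\<And>K. compact K \<Longrightarrow> K \<subseteq> UNIV \<times> U \<Longrightarrow> bounded ((\<lambda>(x, u). c x u) ` K)"
    and h_coercive: "bdd_below (range (\<lambda>x. - h x))" "relatively_compact_sublevels (\<lambda>x. - h x)"
    and ustar_irreducible: "generates_irreducible (gen_ctrl q ustar)"
    and ustar_invariant: "\<And>\<nu>. invariant_law (gen_ctrl q ustar) \<nu> \<Longrightarrow>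
      (\<integral>\<^sup>+x. ennreal (V x) \<partial>measure_pmf \<nu>) < \<infinity>"
  shows "(INF \<nu>. Liminf at_top
             (\<lambda>T::real. ereal (1 / T) * self_transport_value U q V c T \<nu>)) = ereal gstar \<and>
         (ustar \<in> A \<and>
          (\<forall>\<mu>\<in>A. \<forall>\<nu>. invariant_law (gen_ctrl q \<mu>) \<nu> \<longrightarrow>
             (\<integral>\<^sup>+x. ennreal (V x) \<partial>measure_pmf \<nu>) < \<infinity>) \<longrightarrow>
          (\<forall>x0 (M :: ('s discrete \<Rightarrow> 'u) \<Rightarrow> 'w measure) Q.
             (\<forall>\<mu>\<in>A. markov_jump_process (gen_ctrl q \<mu>) x0 (M \<mu>) (Q \<mu>)) \<longrightarrow>
             ergodic_control_value A c M Q = ereal gstar))"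
proof -
  \<comment> \<open>Adding \<open>1\<close> makes the common jump rate positive even if all rates vanish.\<close>
  define \<Lambda> where "\<Lambda> = enn2real (SUP (x, u)\<in>UNIV \<times> U. emeasure (q x u) UNIV) + 1"
  have \<Lambda>: "0 < \<Lambda>" by (simp add: \<Lambda>_def add_nonneg_pos)
  have fin: "emeasure (q x u) UNIV \<le> ennreal \<Lambda>" if "u \<in> U" for x u
  proof -
    have "emeasure (q x u) UNIV \<le> (SUP (x, u)\<in>UNIV \<times> U. emeasure (q x u) UNIV)"
      using that by (intro SUP_upper2[of "(x, u)"]) auto
    also have "\<dots> \<le> ennreal \<Lambda>"
      using rates_bounded by (simp add: \<Lambda>_def ennreal_plus)
    finally show ?thesis .
  qed
  obtain \<kappa>0 :: real where \<kappa>0: "\<And>x. (SUP u\<in>U. \<integral>\<^sup>+y. ennreal (1 + V y) \<partial>q x u) \<le> ennreal (\<kappa>0 * (1 + V x))"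
    using rates_V by blast
  define \<kappa> where "\<kappa> = max 0 \<kappa>0"
  have V1: "0 < 1 + V x" for x using V(1)[of x] by simp
  have \<kappa>: "0 \<le> \<kappa>" "(\<integral>\<^sup>+y. ennreal (1 + V y) \<partial>q x u) \<le> ennreal (\<kappa> * (1 + V x))" if "u \<in> U" for x u
  proof -
    have "(\<integral>\<^sup>+y. ennreal (1 + V y) \<partial>q x u) \<le> (SUP u\<in>U. \<integral>\<^sup>+y. ennreal (1 + V y) \<partial>q x u)"
      using that by (rule SUP_upper)
    also have "\<dots> \<le> ennreal (\<kappa>0 * (1 + V x))" by (rule \<kappa>0)
    also have "\<dots> \<le> ennreal (\<kappa> * (1 + V x))"
      using V1[of x] by (intro ennreal_leI mult_right_mono) (auto simp: \<kappa>_def)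
    finally show "(\<integral>\<^sup>+y. ennreal (1 + V y) \<partial>q x u) \<le> ennreal (\<kappa> * (1 + V x))" .
  qed (simp add: \<kappa>_def)
  obtain k0 where k0: "\<And>x. \<bar>h x\<bar> / (1 + V x) \<le> k0"
    using h_norm by (auto simp: bdd_above_def)
  define k where "k = max 0 k0"
  have k: "0 \<le> k" by (simp add: k_def)
  have hk: "\<bar>h x\<bar> \<le> k * (1 + V x)" for x
  proof -
    have "\<bar>h x\<bar> / (1 + V x) \<le> k" using k0[of x] by (simp add: k_def)
    then show ?thesis using V1[of x] by (simp add: pos_divide_le_eq)
  qed
  obtain m where m: "\<And>x. m \<le> - h x" using h_coercive(1) by (auto simp: bdd_below_def)
  \<comment> \<open>The potential: \<open>h\<close> is bounded above by \<open>- m\<close>.\<close>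
  define \<Psi> where "\<Psi> x = - m - h x" for x
  have \<Psi>: "0 \<le> \<Psi> x" for x using m[of x] by (simp add: \<Psi>_def)
  have \<Psi>V: "\<Psi> x \<le> (\<bar>m\<bar> + k) * (1 + V x)" for x
  proof -
    have "\<Psi> x \<le> \<bar>m\<bar> * 1 + k * (1 + V x)" using hk[of x] by (simp add: \<Psi>_def)
    also have "\<dots> \<le> \<bar>m\<bar> * (1 + V x) + k * (1 + V x)"
      using V(1)[of x] by (intro add_right_mono mult_left_mono) auto
    finally show ?thesis by (simp add: algebra_simps)
  qed
  have us: "ustar x \<in> U" for x using ustar[of x] by (simp add: is_arg_max_def)
  have ineq: "gstar + gen q u h x \<le> c x u" if "u \<in> U" for x u
    using ustar[of x] that hjb[of x] by (force simp: is_arg_max_def gen_ctrl_def not_less)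
  have w0: "0 \<le> 1 + V x" for x using V1[of x] by simp
  have int: "integrable (q x u) h" "integrable (q x u) V" "integrable (q x u) \<Psi>" if u: "u \<in> U" for x u
  proof -
    interpret finite_measure "q x u"
      using fin[OF u, of x] jump_rate_kernel_space[OF q u, of x]
      by (intro finite_measureI) (auto simp: top_unique)
    note gb = gen_bound[OF q u fin[OF u] less_imp_le[OF \<Lambda>] w0 \<kappa>(2)[OF u] \<kappa>(1)[OF u]]
    show h: "integrable (q x u) h" by (rule gb(2)[OF hk k])
    show "integrable (q x u) V"
      by (rule gb(2)[of _ 1]) (use V(1) in auto)
    show "integrable (q x u) \<Psi>" unfolding \<Psi>_def using h by simp
  qed
  have gen_eq: "gen_ctrl q \<mu> f x = (\<integral>y. (f y - f x) \<partial>q x (\<mu> x))" for \<mu> x f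
    by (simp add: gen_ctrl_def gen_def)
  have gen\<Psi>: "gen_ctrl q \<mu> \<Psi> x = - gen_ctrl q \<mu> h x" for \<mu> x
    unfolding gen_ctrl_def gen_def \<Psi>_def by (simp flip: integral_minus)
  \<comment> \<open>The value is nonnegative: at a maximizer \<open>z\<close> of \<open>h\<close> the generator of \<open>h\<close> is at most \<open>0\<close>.\<close>
  have "finite {x. - h x \<le> - h undefined}" (is "finite ?A")
    by (rule finite_sublevel[OF h_coercive(2)])
  then have fA: "finite (h ` ?A)" "h ` ?A \<noteq> {}" by auto
  obtain z where zA: "z \<in> ?A" "h z = Max (h ` ?A)"
    using Max_in[OF fA] by auto
  have z: "h y \<le> h z" for y
    using zA Max_ge[OF fA(1), of "h y"] by (cases "y \<in> ?A") auto
  have "0 \<le> (\<integral>y. (h z - h y) \<partial>q z (ustar z))"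
    using z by (intro Bochner_Integration.integral_nonneg) auto
  also have "\<dots> = - gen_ctrl q ustar h z"
    unfolding gen_ctrl_def gen_def by (simp flip: integral_minus)
  finally have g: "0 \<le> gstar"
    using hjb[of z] cost(1)[OF us, of z z] by simp
  have cm: "(\<lambda>(x, u). ennreal (c x u)) \<in> borel_measurable (state_control_space U)"
  proof -
    have "(\<lambda>(x, u). c x u) \<in> borel_measurable (state_control_space U)"
      using lower_semicontinuous_on_borel_measurable[OF cost_lsc]
      by (intro measurable_pair_measure_countable1) auto
    then show ?thesis by (simp add: split_beta')
  qed
  have inf_le: "(INF u\<in>U. c x u) \<le> c x (ustar x)" for x
    using us cost(1) by (intro cINF_lower) (auto intro!: bdd_belowI2[of _ 0])
  \<comment> \<open>The Lyapunov function \<open>\<Psi>\<close> has drift at most \<open>-1\<close> where the least cost exceeds \<open>gstar + 1\<close>.\<close>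
  have drift: "gen_ctrl q ustar \<Psi> x \<le> - 1 + (gstar + 1) * indicator {x. (INF u\<in>U. c x u) \<le> gstar + 1} x" for x
    using inf_le[of x] hjb[of x] cost(1)[OF us, of x x] by (auto simp: gen\<Psi> split: split_indicator)
  obtain K :: "'s discrete \<Rightarrow> 's discrete pmf" and \<nu> where Kint: "\<And>x (f :: _ \<Rightarrow> real). integrable (q x (ustar x)) f \<Longrightarrow> integrable (K x) f"
    and K: "\<And>x f. integrable (q x (ustar x)) f \<Longrightarrow> gen_ctrl q ustar f x = \<Lambda> * ((\<integral>y. f y \<partial>K x) - f x)"
    and \<nu>: "bind_pmf \<nu> K = \<nu>" "invariant_law (gen_ctrl q ustar) \<nu>"
    and PK: "\<And>P t x. semigroup_generated_by (gen_ctrl q ustar) P \<Longrightarrow> 0 < t \<Longrightarrow>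
        P t x = bind_pmf (poisson_pmf (\<Lambda> * t)) (\<lambda>n. kernel_power K n x)"
    by (rule uniformized_chain[OF jump_rate_kernel_sets[OF q us] \<Lambda> fin[OF us] gen_eq ustar_irreducible
          \<Psi> int(3)[OF us] finite_sublevel[OF cost_coercive] drift]) (rule that; assumption)
  have le: "ennreal \<Lambda> * (\<integral>\<^sup>+y. ennreal (\<Psi> y) \<partial>K x) + ennreal (c x (ustar x)) \<le> ennreal gstar + ennreal \<Lambda> * ennreal (\<Psi> x)" for x
    using K[OF int(3)[OF us], of x] gen\<Psi>[of ustar x] hjb[of x] cost(1)[OF us, of x x]
    by (intro cost_potential_ennreal_le[OF g \<Lambda> \<Psi> Kint[OF int(3)[OF us]]]) auto
  have V\<nu>: "(\<integral>\<^sup>+x. ennreal (V x) \<partial>\<nu>) < \<infinity>" by (rule ustar_invariant[OF \<nu>(2)])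
  have \<Psi>fin: "(\<integral>\<^sup>+x. ennreal (\<Psi> x) \<partial>p) < \<infinity>" if "(\<integral>\<^sup>+x. ennreal (V x) \<partial>p) < \<infinity>" for p :: "'s discrete pmf"
  proof -
    have "(\<integral>\<^sup>+x. ennreal (\<Psi> x) \<partial>p) \<le> (\<integral>\<^sup>+x. ennreal (\<bar>m\<bar> + k) * (1 + ennreal (V x)) \<partial>p)"
      using \<Psi>V k V(1) w0
      by (intro nn_integral_mono)
         (metis (no_types, lifting) abs_ge_zero add_nonneg_nonneg ennreal_1 ennreal_leI ennreal_mult ennreal_plus zero_le_one)
    also have "\<dots> = ennreal (\<bar>m\<bar> + k) * (1 + (\<integral>\<^sup>+x. ennreal (V x) \<partial>p))"
      by (simp add: nn_integral_cmult nn_integral_add)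
    also have "\<dots> < \<infinity>" using that by (simp add: ennreal_mult_less_top)
    finally show ?thesis .
  qed
  \<comment> \<open>Invariance cancels the potential, whose integral is finite because \<open>V\<close> is integrable.\<close>
  have cost\<nu>: "(\<integral>\<^sup>+x. ennreal (c x (ustar x)) \<partial>\<nu>) \<le> ennreal gstar"
  proof -
    have *: "ennreal \<Lambda> * (\<integral>\<^sup>+x. ennreal (\<Psi> x) \<partial>\<nu>) < \<infinity>"
      using \<Psi>fin[OF V\<nu>] by (simp add: ennreal_mult_less_top)
    have "ennreal \<Lambda> * (\<integral>\<^sup>+x. ennreal (\<Psi> x) \<partial>\<nu>) + (\<integral>\<^sup>+x. ennreal (c x (ustar x)) \<partial>\<nu>)
      = ennreal \<Lambda> * (\<integral>\<^sup>+x. ennreal (\<Psi> x) \<partial>bind_pmf \<nu> K) + (\<integral>\<^sup>+x. ennreal (c x (ustar x)) \<partial>\<nu>)"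
      by (simp only: \<nu>(1))
    also have "\<dots> = (\<integral>\<^sup>+x. ennreal \<Lambda> * (\<integral>\<^sup>+y. ennreal (\<Psi> y) \<partial>K x) + ennreal (c x (ustar x)) \<partial>\<nu>)"
      by (simp add: nn_integral_add nn_integral_cmult)
    also have "\<dots> \<le> (\<integral>\<^sup>+x. ennreal gstar + ennreal \<Lambda> * ennreal (\<Psi> x) \<partial>\<nu>)"
      by (intro nn_integral_mono le)
    also have "\<dots> = ennreal \<Lambda> * (\<integral>\<^sup>+x. ennreal (\<Psi> x) \<partial>\<nu>) + ennreal gstar"
      by (simp add: nn_integral_add nn_integral_cmult add.commute)
    finally show ?thesis using * by (auto simp: top_unique)
  qed
  have lower: "ereal gstar \<le> ereal (1 / T) * self_transport_value U q V c T p" if T: "0 < T" for T p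
  proof -
    have "ereal (T * gstar) \<le> self_transport_value U q V c T p"
      unfolding self_transport_value_def
      using transport_cost_ge[OF q V(1) fin less_imp_le[OF \<Lambda>] \<kappa>(2) _ hk k ineq _ less_imp_le[OF T]] \<kappa>(1)[OF us]
      by (intro INF_greatest) auto
    then have "ereal (1 / T) * ereal (T * gstar) \<le> ereal (1 / T) * self_transport_value U q V c T p"
      using T by (intro ereal_mult_left_mono) auto
    then show ?thesis using T by simp
  qed
  have upper: "ereal (1 / T) * self_transport_value U q V c T \<nu> \<le> ereal gstar" if T: "0 < T" for T
  proof -
    obtain \<pi> where "self_transport_plan U q V T \<nu> \<pi>"
      and cost: "(\<integral>\<^sup>+(t, x, u). ennreal (c x u) \<partial>\<pi>) = ennreal T * (\<integral>\<^sup>+x. ennreal (c x (ustar x)) \<partial>\<nu>)"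
      using stationary_plan[OF q V(1) fin less_imp_le[OF \<Lambda>] us K \<nu>(1) V\<nu> less_imp_le[OF T] cm] by blast
    then have "self_transport_value U q V c T \<nu> \<le> enn2ereal (ennreal T * (\<integral>\<^sup>+x. ennreal (c x (ustar x)) \<partial>\<nu>))"
      unfolding self_transport_value_def cost[symmetric] by (intro INF_lower) simp
    also have "\<dots> \<le> enn2ereal (ennreal T * ennreal gstar)"
      unfolding less_eq_ennreal.rep_eq[symmetric] by (rule mult_left_mono[OF cost\<nu>]) simp
    also have "\<dots> = ereal (T * gstar)"
      using T g by (simp add: ennreal_mult[symmetric] enn2ereal_ennreal)
    finally have "ereal (1 / T) * self_transport_value U q V c T \<nu> \<le> ereal (1 / T) * ereal (T * gstar)"
      using T by (intro ereal_mult_left_mono) auto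
    then show ?thesis using T by simp
  qed
  have "(INF \<nu>. Liminf at_top (\<lambda>T::real. ereal (1 / T) * self_transport_value U q V c T \<nu>)) = ereal gstar"
  proof (rule antisym)
    have "Liminf at_top (\<lambda>T::real. ereal (1 / T) * self_transport_value U q V c T \<nu>) \<le> Liminf at_top (\<lambda>T::real. ereal gstar)"
      by (intro Liminf_mono eventually_mono[OF eventually_gt_at_top[of 0]] upper)
    also have "\<dots> = ereal gstar" by (intro Liminf_const) simp
    finally show "(INF \<nu>. Liminf at_top (\<lambda>T::real. ereal (1 / T) * self_transport_value U q V c T \<nu>)) \<le> ereal gstar"
      by (intro INF_lower2[of \<nu>]) auto
    show "ereal gstar \<le> (INF \<nu>. Liminf at_top (\<lambda>T::real. ereal (1 / T) * self_transport_value U q V c T \<nu>))"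
      by (intro INF_greatest Liminf_bounded eventually_mono[OF eventually_gt_at_top[of 0]] lower)
  qed
  moreover have "ergodic_control_value A c M Q = ereal gstar"
    if uA: "ustar \<in> A" and Vinv: "\<And>\<mu> \<nu>. \<mu> \<in> A \<Longrightarrow> invariant_law (gen_ctrl q \<mu>) \<nu> \<Longrightarrow>
             (\<integral>\<^sup>+x. ennreal (V x) \<partial>measure_pmf \<nu>) < \<infinity>"
      and MQ: "\<And>\<mu>. \<mu> \<in> A \<Longrightarrow> markov_jump_process (gen_ctrl q \<mu>) x0 (M \<mu>) (Q \<mu>)"
    for x0 and M :: "('s discrete \<Rightarrow> 'u) \<Rightarrow> 'w measure" and Q
  proof (rule antisym)
    obtain P where P: "semigroup_generated_by (gen_ctrl q ustar) P"
      "\<And>t. 0 \<le> t \<Longrightarrow> distr (M ustar) (count_space UNIV) (Q ustar t) = measure_pmf (P t x0)"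
      using markov_jump_process_law[OF MQ[OF uA]] by blast
    have "long_run_cost c ustar (M ustar) (Q ustar) \<le> ereal gstar"
      unfolding long_run_cost_def
    proof (rule Limsup_average_le[OF g \<Psi>[of x0]])
      fix T :: real assume T: "0 < T"
      have "(\<integral>\<^sup>+s\<in>{0..T}. (\<integral>\<^sup>+y. ennreal (c y (ustar y)) \<partial>P s x0) \<partial>lborel) \<le> ennreal (T * gstar + \<Psi> x0)"
        by (rule occupation_cost_le[OF \<Lambda> T g \<Psi> PK[OF P(1)] le])
      then show "(\<integral>\<^sup>+\<omega>. (\<integral>\<^sup>+s\<in>{0..T}. ennreal (c (Q ustar s \<omega>) (ustar (Q ustar s \<omega>))) \<partial>lborel) \<partial>M ustar)
          \<le> ennreal (T * gstar + \<Psi> x0)"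
        using markov_jump_process_occupation[where f="\<lambda>y. ennreal (c y (ustar y))" and P=P and T=T, OF MQ[OF uA]] P(2)
        by simp
    qed
    then show "ergodic_control_value A c M Q \<le> ereal gstar"
      unfolding ergodic_control_value_def by (rule INF_lower2[OF uA])
    show "ereal gstar \<le> ergodic_control_value A c M Q"
      unfolding ergodic_control_value_def
    proof (rule INF_greatest)
      fix \<mu> assume \<mu>: "\<mu> \<in> A"
      note \<mu>U = controls[OF \<mu>]
      \<comment> \<open>For a general control the Lyapunov function is \<open>V\<close>, since \<open>W \<ge> 1\<close>.\<close>
      have driftV: "gen_ctrl q \<mu> V x \<le> - 1 + b * indicator C x" for x
        using stability_drift[OF \<mu>, of x] W[of x] by simp
      obtain K :: "'s discrete \<Rightarrow> 's discrete pmf" and \<nu> where Kint: "\<And>x (f :: _ \<Rightarrow> real). integrable (q x (\<mu> x)) f \<Longrightarrow> integrable (K x) f"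
        and K: "\<And>x f. integrable (q x (\<mu> x)) f \<Longrightarrow> gen_ctrl q \<mu> f x = \<Lambda> * ((\<integral>y. f y \<partial>K x) - f x)"
        and \<nu>: "bind_pmf \<nu> K = \<nu>" "invariant_law (gen_ctrl q \<mu>) \<nu>" "\<And>x. 0 < pmf \<nu> x"
        and PK: "\<And>P t x. semigroup_generated_by (gen_ctrl q \<mu>) P \<Longrightarrow> 0 < t \<Longrightarrow>
            P t x = bind_pmf (poisson_pmf (\<Lambda> * t)) (\<lambda>n. kernel_power K n x)"
        by (rule uniformized_chain[OF jump_rate_kernel_sets[OF q \<mu>U] \<Lambda> fin[OF \<mu>U] gen_eq stability_irreducible[OF \<mu>]
              V(1) int(2)[OF \<mu>U] compact_discrete_imp_finite[OF C] driftV]) (rule that; assumption)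
      have ge: "ennreal gstar + ennreal \<Lambda> * ennreal (\<Psi> x)
          \<le> ennreal \<Lambda> * (\<integral>\<^sup>+y. ennreal (\<Psi> y) \<partial>K x) + ennreal (c x (\<mu> x))" for x
        using K[OF int(3)[OF \<mu>U], of x] gen\<Psi>[of \<mu> x] ineq[OF \<mu>U, of x x] cost(1)[OF \<mu>U, of x x]
        by (intro cost_potential_ennreal_ge[OF g \<Lambda> \<Psi> Kint[OF int(3)[OF \<mu>U]]]) (auto simp: gen_ctrl_def)
      obtain I where I: "0 \<le> I" "(\<integral>\<^sup>+x. ennreal (\<Psi> x) \<partial>\<nu>) = ennreal I"
        using \<Psi>fin[OF Vinv[OF \<mu> \<nu>(2)]] by (cases "\<integral>\<^sup>+x. ennreal (\<Psi> x) \<partial>\<nu>") auto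
      \<comment> \<open>The bound on the expected potential at all steps, from domination by the stationary chain.\<close>
      define B where "B = I / pmf \<nu> x0"
      have B: "0 \<le> B" using I(1) by (simp add: B_def)
      have bd: "(\<integral>\<^sup>+y. ennreal (\<Psi> y) \<partial>kernel_power K n x0) \<le> ennreal B" for n
      proof -
        have "ennreal (1 / pmf \<nu> x0) * (ennreal (pmf \<nu> x0) * (\<integral>\<^sup>+y. ennreal (\<Psi> y) \<partial>kernel_power K n x0))
            \<le> ennreal (1 / pmf \<nu> x0) * ennreal I"
          unfolding I(2)[symmetric] by (intro mult_left_mono kernel_power_moment[OF \<nu>(1)]) simp
        then show ?thesis
          using \<nu>(3)[of x0] I(1) by (simp add: mult.assoc[symmetric] ennreal_mult[symmetric] B_def)
      qed
      obtain P where P: "semigroup_generated_by (gen_ctrl q \<mu>) P"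
        "\<And>t. 0 \<le> t \<Longrightarrow> distr (M \<mu>) (count_space UNIV) (Q \<mu> t) = measure_pmf (P t x0)"
        using markov_jump_process_law[OF MQ[OF \<mu>]] by blast
      show "ereal gstar \<le> long_run_cost c \<mu> (M \<mu>) (Q \<mu>)"
        unfolding long_run_cost_def
      proof (rule Limsup_average_ge[OF g B])
        fix T :: real assume T: "0 < T"
        have "ennreal (T * gstar) \<le> ennreal B + (\<integral>\<^sup>+s\<in>{0..T}. (\<integral>\<^sup>+y. ennreal (c y (\<mu> y)) \<partial>P s x0) \<partial>lborel)"
          by (rule occupation_cost_ge[where P=P and K=K and x=x0 and \<Psi>="\<lambda>y. ennreal (\<Psi> y)"
                and f="\<lambda>y. ennreal (c y (\<mu> y))", OF \<Lambda> T g B PK[OF P(1)] ge bd])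
        then show "ennreal (T * gstar) \<le> ennreal B +
            (\<integral>\<^sup>+\<omega>. (\<integral>\<^sup>+s\<in>{0..T}. ennreal (c (Q \<mu> s \<omega>) (\<mu> (Q \<mu> s \<omega>))) \<partial>lborel) \<partial>M \<mu>)"
          using markov_jump_process_occupation[where f="\<lambda>y. ennreal (c y (\<mu> y))" and P=P and T=T, OF MQ[OF \<mu>]] P(2)
          by simp
      qed
    qed
  qed
  ultimately show ?thesis by blast
qed

end
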